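(* Let $\varphi\colon\mathbb{R}_+\to\mathbb{R}_+$ be a sublinear map and $S$ an odometer. There exists a probability measure-preserving transformation $T$ such that $S$ and $T$ are $\varphi$-integrably orbit equivalent but not flip-conjugate.
   Context: Sublinear means $\lim_{t\to+\infty}\varphi(t)/t=0$. Transformations are bimeasurable measure-preserving bijections of standard atomless probability spaces, up to null sets. For integers $q_n\geq 2$ ($n\ge 0$), the odometer on $X=\prod_{n\geq 0}\{0,\ldots,q_n-1\}$, equipped with the product $\mu$ of the uniform measures, is the addition of $(1,0,0,\ldots)$ with carry over to the right. An orbit equivalence between aperiodic transformations $S$ of $(X,\mu)$ and $T$ of $(Y,\nu)$ is a bimeasurable bijection $\Psi\colon X\to Y$ with $\Psi_\star\mu=\nu$ such that $S$ and $\Psi^{-1}T\Psi$ have the same orbit at almost every point of $X$. Its cocycles $c_S\colon X\to\mathbb{Z}$, $c_T\colon Y\to\mathbb{Z}$ are given almost everywhere by $Sx=\Psi^{-1}T^{c_S(x)}\Psi(x)$ and $Ty=\Psi S^{c_T(y)}\Psi^{-1}(y)$. $S$ and $T$ are $\varphi$-integrably orbit equivalent if there is an orbit equivalence for which $\int_X\varphi(|c_S|)\,d\mu<+\infty$ and $\int_Y\varphi(|c_T|)\,d\nu<+\infty$. $S$ and $T$ are flip-conjugate if $T$ is conjugate (measure-theoretically isomorphic) to $S$ or to $S^{-1}$. *)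

theory Defs
  imports "HOL-Probability.Probability"
begin

definition standard_borel_space :: "'a measure \<Rightarrow> bool" where
  "standard_borel_space M \<longleftrightarrow>
     (\<exists>X. topspace X = space M \<and> completely_metrizable_space X \<and> second_countable X \<and>
          sets M = sigma_sets (space M) {U. openin X U})"

definition atomless :: "'a measure \<Rightarrow> bool" where
  "atomless M \<longleftrightarrow>
     (\<forall>A\<in>sets M. 0 < emeasure M A \<longrightarrow>
        (\<exists>B\<in>sets M. B \<subseteq> A \<and> 0 < emeasure M B \<and> emeasure M B < emeasure M A))"

definition standard_atomless_prob_space :: "'a measure \<Rightarrow> bool" where
  "standard_atomless_prob_space M \<longleftrightarrow> prob_space M \<and> standard_borel_space M \<and> atomless M"

definition mp_bijection :: "'a measure \<Rightarrow> 'b measure \<Rightarrow> ('a \<Rightarrow> 'b) \<Rightarrow> bool" where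
  "mp_bijection M N f \<longleftrightarrow>
     bij_betw f (space M) (space N) \<and>
     f \<in> measurable M N \<and> inv_into (space M) f \<in> measurable N M \<and>
     distr M N f = N"

text \<open>
  A bijection between conull sets that is bimeasurable and measure-preserving agrees almost
  everywhere with a bijection of the whole space (restrict it to a conull invariant set and
  extend by the identity), so transformations are taken to be bijective everywhere. Equality of
  transformations is only ever used almost everywhere.
\<close>

definition pmp_transformation :: "'a measure \<Rightarrow> ('a \<Rightarrow> 'a) \<Rightarrow> bool" where
  "pmp_transformation M T \<longleftrightarrow> standard_atomless_prob_space M \<and> mp_bijection M M T"

definition transf_inv :: "'a measure \<Rightarrow> ('a \<Rightarrow> 'a) \<Rightarrow> 'a \<Rightarrow> 'a" where
  "transf_inv M T = inv_into (space M) T"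

definition transf_pow :: "'a measure \<Rightarrow> ('a \<Rightarrow> 'a) \<Rightarrow> int \<Rightarrow> 'a \<Rightarrow> 'a" where
  "transf_pow M T k = (if 0 \<le> k then T ^^ nat k else transf_inv M T ^^ nat (- k))"

definition orbit_of :: "'a measure \<Rightarrow> ('a \<Rightarrow> 'a) \<Rightarrow> 'a \<Rightarrow> 'a set" where
  "orbit_of M T x = range (\<lambda>k. transf_pow M T k x)"

definition aperiodic :: "'a measure \<Rightarrow> ('a \<Rightarrow> 'a) \<Rightarrow> bool" where
  "aperiodic M T \<longleftrightarrow> (AE x in M. \<forall>n>0. (T ^^ n) x \<noteq> x)"

text \<open>Measure-theoretic isomorphism: the conjugating map is a bijection between conull sets.\<close>

definition conjugate :: "'a measure \<Rightarrow> ('a \<Rightarrow> 'a) \<Rightarrow> 'b measure \<Rightarrow> ('b \<Rightarrow> 'b) \<Rightarrow> bool" where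
  "conjugate M S N T \<longleftrightarrow>
     (\<exists>A\<in>sets M. \<exists>B\<in>sets N. \<exists>f.
        (AE x in M. x \<in> A) \<and> (AE y in N. y \<in> B) \<and>
        mp_bijection (restrict_space M A) (restrict_space N B) f \<and>
        (AE x in M. f (S x) = T (f x)))"

definition flip_conjugate :: "'a measure \<Rightarrow> ('a \<Rightarrow> 'a) \<Rightarrow> 'b measure \<Rightarrow> ('b \<Rightarrow> 'b) \<Rightarrow> bool" where
  "flip_conjugate M S N T \<longleftrightarrow> conjugate M S N T \<or> conjugate M (transf_inv M S) N T"

definition orbit_equivalence ::
  "'a measure \<Rightarrow> ('a \<Rightarrow> 'a) \<Rightarrow> 'b measure \<Rightarrow> ('b \<Rightarrow> 'b) \<Rightarrow> ('a \<Rightarrow> 'b) \<Rightarrow> bool" where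
  "orbit_equivalence M S N T \<Psi> \<longleftrightarrow>
     pmp_transformation M S \<and> aperiodic M S \<and>
     pmp_transformation N T \<and> aperiodic N T \<and>
     mp_bijection M N \<Psi> \<and>
     (AE x in M. orbit_of M S x = orbit_of M (inv_into (space M) \<Psi> \<circ> T \<circ> \<Psi>) x)"

text \<open>
  The cocycles of an orbit equivalence are determined up to null sets, by aperiodicity;
  these predicates say that an integer-valued function is a version of the cocycle.
\<close>

definition source_cocycle ::
  "'a measure \<Rightarrow> ('a \<Rightarrow> 'a) \<Rightarrow> 'b measure \<Rightarrow> ('b \<Rightarrow> 'b) \<Rightarrow> ('a \<Rightarrow> 'b) \<Rightarrow> ('a \<Rightarrow> int) \<Rightarrow> bool" where
  "source_cocycle M S N T \<Psi> c \<longleftrightarrow>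
     c \<in> measurable M (count_space UNIV) \<and>
     (AE x in M. S x = inv_into (space M) \<Psi> (transf_pow N T (c x) (\<Psi> x)))"

definition target_cocycle ::
  "'a measure \<Rightarrow> ('a \<Rightarrow> 'a) \<Rightarrow> 'b measure \<Rightarrow> ('b \<Rightarrow> 'b) \<Rightarrow> ('a \<Rightarrow> 'b) \<Rightarrow> ('b \<Rightarrow> int) \<Rightarrow> bool" where
  "target_cocycle M S N T \<Psi> c \<longleftrightarrow>
     c \<in> measurable N (count_space UNIV) \<and>
     (AE y in N. T y = \<Psi> (transf_pow M S (c y) (inv_into (space M) \<Psi> y)))"

text \<open>
  Here \<open>\<phi>\<close> is meant to be nonnegative on the nonnegative reals, the only place where it is
  evaluated, so that \<open>ennreal\<close> does not truncate.
\<close>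

definition integrably_orbit_equivalent ::
  "(real \<Rightarrow> real) \<Rightarrow> 'a measure \<Rightarrow> ('a \<Rightarrow> 'a) \<Rightarrow> 'b measure \<Rightarrow> ('b \<Rightarrow> 'b) \<Rightarrow> bool" where
  "integrably_orbit_equivalent \<phi> M S N T \<longleftrightarrow>
     (\<exists>\<Psi> c_S c_T.
        orbit_equivalence M S N T \<Psi> \<and>
        source_cocycle M S N T \<Psi> c_S \<and> target_cocycle M S N T \<Psi> c_T \<and>
        (\<integral>\<^sup>+ x. ennreal (\<phi> (real_of_int \<bar>c_S x\<bar>)) \<partial>M) < \<infinity> \<and>
        (\<integral>\<^sup>+ y. ennreal (\<phi> (real_of_int \<bar>c_T y\<bar>)) \<partial>N) < \<infinity>)"

definition odometer_space :: "(nat \<Rightarrow> nat) \<Rightarrow> (nat \<Rightarrow> nat) measure" where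
  "odometer_space q = PiM UNIV (\<lambda>n. uniform_count_measure {..<q n})"

text \<open>Addition of digit sequences in the mixed radix \<open>q\<close>, with carry over to the right.\<close>

primrec carry :: "(nat \<Rightarrow> nat) \<Rightarrow> (nat \<Rightarrow> nat) \<Rightarrow> (nat \<Rightarrow> nat) \<Rightarrow> nat \<Rightarrow> nat" where
  "carry q x y 0 = 0"
| "carry q x y (Suc n) = (x n + y n + carry q x y n) div q n"

definition add_with_carry ::
  "(nat \<Rightarrow> nat) \<Rightarrow> (nat \<Rightarrow> nat) \<Rightarrow> (nat \<Rightarrow> nat) \<Rightarrow> nat \<Rightarrow> nat" where
  "add_with_carry q x y = (\<lambda>n. (x n + y n + carry q x y n) mod q n)"

definition odometer :: "(nat \<Rightarrow> nat) \<Rightarrow> (nat \<Rightarrow> nat) \<Rightarrow> (nat \<Rightarrow> nat)" where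
  "odometer q x = add_with_carry q x (\<lambda>n. if n = 0 then 1 else 0)"

definition sublinear :: "(real \<Rightarrow> real) \<Rightarrow> bool" where
  "sublinear \<phi> \<longleftrightarrow> ((\<lambda>t. \<phi> t / t) \<longlongrightarrow> 0) at_top"

end

theory Submission
  imports Defs
begin

text \<open>
  Let \<open>S\<close> be the odometer. After grouping the digits into blocks, the radices \<open>q n\<close> may be assumed
  to grow as fast as we like. Let \<open>\<psi>\<close> be the map that swaps each digit within its pair
  \<open>{2 j, 2 j + 1}\<close> whenever the next digit is odd. It preserves the measure and is a bijection on every
  class of sequences with the same tail, and up to null sets these classes are the orbits of \<open>S\<close>.
  So there is a unique \<open>T\<close> with the orbits of \<open>S\<close> and \<open>\<psi> \<circ> T = S \<circ> \<psi>\<close>.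

  If the carry in \<open>S\<close> stops at the digit \<open>n\<close>, an event of probability at most \<open>1 / h\<close> for
  \<open>h = q 0 \<cdots> q (n - 1)\<close>, then applying \<open>\<psi>\<close> changes the digit \<open>n\<close> by at most 3 and leaves all later
  ones, so the cocycles are at most \<open>4 h\<close> there. Hence the integrals are at most
  \<open>\<Sum> max \<phi>{0..4 h} / h\<close>, which converges when the radices grow fast.

  By ergodicity every factor map of \<open>S\<close> to itself is a translation, hence injective. A conjugacy of
  \<open>S\<close> (or its inverse) with \<open>T\<close>, followed by \<open>\<psi>\<close>, would be such a map; but \<open>\<psi>\<close> is not almost
  everywhere injective: swapping all digits at once does not change \<open>\<psi> x\<close>, unless
  a digit of \<open>x\<close> is unpaired.
\<close>

section \<open>Translations of the mixed radix digit space\<close>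

definition place :: "(nat \<Rightarrow> nat) \<Rightarrow> nat \<Rightarrow> nat" where
  "place q n = (\<Prod>k<n. q k)"

definition trunc :: "(nat \<Rightarrow> nat) \<Rightarrow> nat \<Rightarrow> (nat \<Rightarrow> nat) \<Rightarrow> nat" where
  "trunc q n x = (\<Sum>k<n. x k * place q k)"

text \<open>Addition of an integer in the inverse limit of the rings of residues modulo
  \<open>place q n\<close>. Residues are used instead of carries so that negative \<open>k\<close>
  is covered and translations compose by adding integers.\<close>

definition translate :: "(nat \<Rightarrow> nat) \<Rightarrow> int \<Rightarrow> (nat \<Rightarrow> nat) \<Rightarrow> nat \<Rightarrow> nat" where
  "translate q k x =
     (\<lambda>n. nat ((int (trunc q (Suc n) x) + k) mod int (place q (Suc n))) div place q n)"

lemma place_0 [simp]: "place q 0 = 1"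
  by (simp add: place_def)

lemma place_Suc: "place q (Suc n) = place q n * q n"
  by (simp add: place_def)

lemma trunc_0 [simp]: "trunc q 0 x = 0"
  by (simp add: trunc_def)

lemma trunc_Suc: "trunc q (Suc n) x = trunc q n x + x n * place q n"
  by (simp add: trunc_def)

lemma trunc_cong: "(\<And>k. k < n \<Longrightarrow> x k = y k) \<Longrightarrow> trunc q n x = trunc q n y"
  by (simp add: trunc_def)

locale mixed_radix =
  fixes q :: "nat \<Rightarrow> nat"
  assumes q_ge2: "\<And>n. 2 \<le> q n"
begin

abbreviation "M \<equiv> odometer_space q"
abbreviation "X \<equiv> space (odometer_space q)"

lemma space_odometer: "X = {x. \<forall>n. x n < q n}"
  by (auto simp: odometer_space_def space_PiM PiE_UNIV_domain space_uniform_count_measure Pi_iff)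

lemma digit_less: "x \<in> X \<Longrightarrow> x n < q n"
  by (simp add: space_odometer)

lemma q_pos [simp]: "0 < q n"
  using q_ge2[of n] by simp

lemma place_pos [simp]: "0 < place q n"
  by (simp add: place_def prod_pos)

lemma place_dvd: "m \<le> n \<Longrightarrow> place q m dvd place q n"
  unfolding place_def by (intro prod_dvd_prod_subset) auto

lemma two_power_le_place: "2 ^ n \<le> place q n"
proof (induction n)
  case (Suc n)
  then show ?case using mult_mono[OF Suc q_ge2[of n]] by (simp add: place_Suc mult.commute)
qed simp

lemma trunc_less: "x \<in> X \<Longrightarrow> trunc q n x < place q n"
proof (induction n)
  case (Suc n)
  have "trunc q (Suc n) x < place q n + x n * place q n"
    using Suc by (simp add: trunc_Suc)
  also have "\<dots> = (x n + 1) * place q n" by simp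
  also have "\<dots> \<le> q n * place q n"
    using digit_less[OF Suc.prems, of n] by (intro mult_right_mono) auto
  finally show ?case by (simp add: place_Suc mult.commute)
qed simp

lemma trunc_Suc_div: "x \<in> X \<Longrightarrow> trunc q (Suc n) x div place q n = x n"
  using trunc_less[of x n] by (simp add: trunc_Suc div_mult_self1)

lemma trunc_Suc_mod: "x \<in> X \<Longrightarrow> trunc q (Suc n) x mod place q n = trunc q n x"
  using trunc_less[of x n] by (simp add: trunc_Suc)

lemma trunc_mod:
  assumes "x \<in> X" "m \<le> n"
  shows "trunc q n x mod place q m = trunc q m x"
  using assms(2)
proof (induction n rule: dec_induct)
  case base
  then show ?case using trunc_less[OF assms(1), of m] by simp
next
  case (step n)
  have "trunc q (Suc n) x mod place q m = trunc q (Suc n) x mod place q n mod place q m"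
    using place_dvd[OF step.hyps(1)] by (simp add: mod_mod_cancel)
  then show ?case using step trunc_Suc_mod[OF assms(1), of n] by simp
qed

text \<open>Reducing modulo \<open>place q (Suc k)\<close> and then dividing by
  \<open>place q k\<close> recovers the digit \<open>k\<close>, so a truncation is a faithful code
  for a cylinder.\<close>

lemma trunc_eq_iff:
  assumes "x \<in> X" "y \<in> X"
  shows "trunc q n x = trunc q n y \<longleftrightarrow> (\<forall>k<n. x k = y k)"
proof
  assume eq: "trunc q n x = trunc q n y"
  show "\<forall>k<n. x k = y k"
  proof (intro allI impI)
    fix k assume "k < n"
    then have "Suc k \<le> n" by simp
    then have "trunc q (Suc k) x = trunc q (Suc k) y"
      using trunc_mod[OF assms(1)] trunc_mod[OF assms(2)] eq by metis
    then show "x k = y k"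
      using trunc_Suc_div[OF assms(1)] trunc_Suc_div[OF assms(2)] by metis
  qed
qed (auto intro: trunc_cong)

text \<open>The threshold \<open>m\<close> serves points with a common tail, whose truncations are
  compared only from some level on.\<close>

lemma eqI_trunc:
  assumes "x \<in> X" "y \<in> X" "\<And>n. n \<ge> m \<Longrightarrow> trunc q n x = trunc q n y"
  shows "x = y"
proof
  fix k
  show "x k = y k"
    using trunc_eq_iff[OF assms(1,2), of "max m (Suc k)"] assms(3)[of "max m (Suc k)"] by simp
qed

text \<open>The space is the inverse limit of the rings of integers modulo \<^term>\<open>place q n\<close>.\<close>

lemma coherent_digits:
  assumes "\<And>n. r n < place q n" "\<And>n. r (Suc n) mod place q n = r n"
  defines "x \<equiv> \<lambda>n. r (Suc n) div place q n"
  shows "x \<in> X" "trunc q n x = r n"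
proof -
  show "x \<in> X"
    unfolding space_odometer x_def using assms(1)[of "Suc _"]
    by (auto intro!: less_mult_imp_div_less simp: place_Suc mult.commute)
  show "trunc q n x = r n"
  proof (induction n)
    case 0
    then show ?case using assms(1)[of 0] by simp
  next
    case (Suc n)
    then show ?case using assms(2)[of n] mod_div_mult_eq[of "r (Suc n)" "place q n"]
      by (simp add: trunc_Suc x_def)
  qed
qed

text \<open>Each digit is a quotient of a residue below \<open>place q (Suc n)\<close>, hence lies
  in the right range. The truncation formula comes from the coherence of these residues under
  reduction, through \<open>coherent_digits\<close>.\<close>

lemma translate_in_space: "translate q k x \<in> X"
  and trunc_translate_aux: "x \<in> X \<Longrightarrow>
    trunc q n (translate q k x) = nat ((int (trunc q n x) + k) mod int (place q n))"
proof -
  define r where "r n = nat ((int (trunc q n x) + k) mod int (place q n))" for n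
  have lt: "r n < place q n" for n
    unfolding r_def by (simp add: nat_less_iff)
  have tr: "translate q k x = (\<lambda>n. r (Suc n) div place q n)"
    by (simp add: translate_def r_def)
  show "translate q k x \<in> X"
    unfolding tr space_odometer using lt[of "Suc _"]
    by (auto intro!: less_mult_imp_div_less simp: place_Suc mult.commute)
  assume x: "x \<in> X"
  have "r (Suc n) mod place q n = r n" for n
  proof -
    have "int (r (Suc n) mod place q n) =
        (int (trunc q (Suc n) x) + k) mod int (place q (Suc n)) mod int (place q n)"
      by (simp add: r_def zmod_int)
    also have "\<dots> = (int (trunc q (Suc n) x) + k) mod int (place q n)"
      by (intro mod_mod_cancel) (simp add: place_Suc)
    also have "\<dots> = (int (trunc q n x) + k) mod int (place q n)"
      by (metis mod_add_left_eq of_nat_mod trunc_Suc_mod[OF x])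
    finally show ?thesis by (simp add: r_def nat_eq_iff)
  qed
  from coherent_digits(2)[OF lt this]
  show "trunc q n (translate q k x) = nat ((int (trunc q n x) + k) mod int (place q n))"
    by (simp add: tr r_def)
qed

lemma trunc_translate:
  "x \<in> X \<Longrightarrow> int (trunc q n (translate q k x)) = (int (trunc q n x) + k) mod int (place q n)"
  by (simp add: trunc_translate_aux)

lemma eqI_int_trunc:
  assumes "x \<in> X" "y \<in> X" "\<And>n. n \<ge> m \<Longrightarrow> int (trunc q n x) = int (trunc q n y)"
  shows "x = y"
  using assms by (intro eqI_trunc[of x y m]) simp_all

lemma translate_0 [simp]: "x \<in> X \<Longrightarrow> translate q 0 x = x"
  using trunc_less[of x] by (intro eqI_int_trunc translate_in_space) (auto simp: trunc_translate)

lemma translate_translate: "x \<in> X \<Longrightarrow> translate q j (translate q k x) = translate q (j + k) x"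
  by (intro eqI_int_trunc translate_in_space)
     (simp add: trunc_translate translate_in_space mod_simps ac_simps)

lemma translate_inverse [simp]:
  "x \<in> X \<Longrightarrow> translate q k (translate q (- k) x) = x"
  "x \<in> X \<Longrightarrow> translate q (- k) (translate q k x) = x"
  by (simp_all add: translate_translate)

text \<open>A fixed point forces \<open>place q n\<close> to divide \<open>k\<close> at every level
  \<open>n\<close>. The level \<open>n = nat \<bar>k\<bar>\<close> is enough, because
  \<open>place q n\<close> is at least \<open>2 ^ n\<close> and so exceeds the absolute value of
  \<open>k\<close>.\<close>

lemma translate_fixed_point:
  assumes "x \<in> X" "translate q k x = x"
  shows "k = 0"
proof (rule ccontr)
  assume "k \<noteq> 0"
  define n where "n = nat \<bar>k\<bar>"
  have "(int (trunc q n x) + k) mod int (place q n) = int (trunc q n x) mod int (place q n)"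
    using trunc_translate[OF assms(1), of n k] assms(2) trunc_less[OF assms(1), of n] by simp
  then have "int (place q n) dvd k"
    by (metis add_diff_cancel_left' mod_eq_dvd_iff)
  then have "int (place q n) \<le> \<bar>k\<bar>"
    using dvd_imp_le_int[OF \<open>k \<noteq> 0\<close>, of "int (place q n)"] by simp
  moreover have "n < place q n"
    using less_le_trans[OF less_exp two_power_le_place] .
  ultimately show False by (simp add: n_def)
qed

lemma translate_inj:
  assumes "x \<in> X" "translate q j x = translate q k x"
  shows "j = k"
proof -
  have "translate q (- k) (translate q j x) = x"
    using assms by simp
  then have "translate q (j - k) x = x"
    using assms(1) by (simp add: translate_translate)
  then show ?thesis using translate_fixed_point[OF assms(1), of "j - k"] by simp
qed

lemma odometer_eq_translate:
  assumes "x \<in> X"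
  shows "odometer q x = translate q 1 x"
proof -
  define d :: "nat \<Rightarrow> nat" where "d = (\<lambda>n. if n = 0 then 1 else 0)"
  \<comment> \<open>The carry entering the digit \<open>n\<close>. The value 1 at 0 absorbs the
    added sequence (1, 0, 0, ...), so that all digits obey one recursion.\<close>
  define e where "e n = (if n = 0 then 1 else carry q x d n)" for n
  have o: "odometer q x n = (x n + e n) mod q n" for n
    by (cases n) (simp_all add: odometer_def add_with_carry_def d_def e_def)
  have c: "e (Suc n) = (x n + e n) div q n" for n
    by (cases n) (simp_all add: e_def d_def)
  \<comment> \<open>Addition of 1 to the truncation, with the outgoing carry as the excess; it
    vanishes modulo \<open>place q n\<close>.\<close>
  have main: "trunc q n x + 1 = trunc q n (odometer q x) + e n * place q n" for n
  proof (induction n)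
    case 0
    then show ?case by (simp add: e_def)
  next
    case (Suc n)
    have "x n + e n = odometer q x n + q n * e (Suc n)"
      unfolding o c by simp
    then have "(x n + e n) * place q n = (odometer q x n + q n * e (Suc n)) * place q n"
      by simp
    with Suc show ?case by (simp add: trunc_Suc place_Suc algebra_simps)
  qed
  have X: "odometer q x \<in> X"
    unfolding space_odometer by (simp add: o)
  show ?thesis
  proof (rule eqI_int_trunc[OF X translate_in_space])
    fix n
    have "int (trunc q n (odometer q x)) = int (trunc q n (odometer q x)) mod int (place q n)"
      using trunc_less[OF X, of n] by simp
    also have "\<dots> = int (trunc q n (odometer q x) + e n * place q n) mod int (place q n)"
      by simp
    also have "\<dots> = (int (trunc q n x) + 1) mod int (place q n)"
      unfolding main[symmetric] by (simp add: add.commute)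
    finally show "int (trunc q n (odometer q x)) = int (trunc q n (translate q 1 x))"
      by (simp add: trunc_translate[OF assms])
  qed
qed

text \<open>Equal digits contribute equally to both truncations, so their difference is constant
  from level \<open>m\<close> on; this constant is the translation amount.\<close>

lemma eq_translate_if_same_tail:
  assumes "x \<in> X" "y \<in> X" "\<And>k. m \<le> k \<Longrightarrow> x k = y k"
  shows "y = translate q (int (trunc q m y) - int (trunc q m x)) x"
proof (rule eqI_int_trunc[OF assms(2) translate_in_space, of m])
  fix n assume "m \<le> n"
  then have "int (trunc q n y) - int (trunc q n x) = int (trunc q m y) - int (trunc q m x)"
  proof (induction n rule: dec_induct)
    case (step n)
    then show ?case using assms(3)[of n] by (simp add: trunc_Suc)
  qed simp
  then have "int (trunc q n x) + (int (trunc q m y) - int (trunc q m x)) = int (trunc q n y)"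
    by simp
  then show "int (trunc q n y) =
      int (trunc q n (translate q (int (trunc q m y) - int (trunc q m x)) x))"
    using trunc_less[OF assms(2), of n] by (simp add: trunc_translate assms)
qed

lemma trunc_max_digits:
  assumes "\<And>k. k < n \<Longrightarrow> x k = q k - 1"
  shows "trunc q n x + 1 = place q n"
  using assms
proof (induction n)
  case (Suc n)
  have "trunc q (Suc n) x + 1 = place q n + (q n - 1) * place q n"
    using Suc.IH Suc.prems by (simp add: trunc_Suc)
  also have "\<dots> = (1 + (q n - 1)) * place q n" by (simp only: add_mult_distrib mult_1)
  also have "1 + (q n - 1) = q n" using q_pos[of n] by simp
  finally show ?case by (simp add: place_Suc mult.commute)
qed simp

text \<open>The maximal digits below \<open>n\<close> are worth \<open>place q n - 1\<close>, so
  resetting them and raising the digit \<open>n\<close> by one increases the truncation by exactly 1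
  and leaves the tail alone.\<close>

lemma translate_1_carry:
  assumes "x \<in> X" "\<And>k. k < n \<Longrightarrow> x k = q k - 1" "Suc (x n) < q n"
  shows "translate q 1 x = (\<lambda>k. if k < n then 0 else if k = n then Suc (x n) else x k)"
    (is "_ = ?y")
proof -
  have y: "?y \<in> X"
    using assms(1,3) by (simp add: space_odometer)
  have "trunc q n ?y = 0" by (simp add: trunc_def)
  then have "int (trunc q (Suc n) ?y) - int (trunc q (Suc n) x) = 1"
    by (simp add: trunc_Suc flip: trunc_max_digits[OF assms(2)])
  then show ?thesis using eq_translate_if_same_tail[OF assms(1) y, of "Suc n"] by simp
qed

section \<open>The product measure, its cylinders and ergodicity\<close>

sublocale prob_space "odometer_space q"
  unfolding odometer_space_def
  by (intro prob_space_PiM prob_space_uniform_count_measure) (auto simp: lessThan_empty_iff)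

lemma measurable_digit [measurable]: "(\<lambda>x. x n) \<in> measurable (odometer_space q) (count_space UNIV)"
proof -
  have "(\<lambda>x. x n) \<in> measurable (odometer_space q) (uniform_count_measure {..<q n})"
    unfolding odometer_space_def by (rule measurable_component_singleton) simp
  also have "\<dots> = measurable (odometer_space q) (count_space {..<q n})"
    by (intro measurable_cong_sets) (simp_all add: sets_uniform_count_measure)
  finally have m: "(\<lambda>x. x n) \<in> measurable (odometer_space q) (count_space {..<q n})" .
  show ?thesis
    by (rule measurable_compose[OF m]) simp
qed

lemma measurable_trunc [measurable]:
  "trunc q n \<in> measurable (odometer_space q) (count_space UNIV)"
proof -
  have eq: "measurable M (count_space (UNIV :: nat set)) = borel_measurable M"
    by (rule measurable_cong_sets[OF refl]) (simp add: sets_borel_eq_count_space)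
  have [measurable]: "(\<lambda>x. x k * c) \<in> borel_measurable M" for k c
    using measurable_compose[OF measurable_digit[of k], of "\<lambda>d. d * c" "count_space UNIV"]
    by (simp add: eq)
  have "(\<lambda>x. \<Sum>k<n. x k * place q k) \<in> borel_measurable M"
    by measurable
  then show ?thesis
    by (simp add: eq trunc_def[abs_def])
qed

lemma measurable_into_odometer_space:
  assumes "\<And>x. x \<in> space N \<Longrightarrow> f x \<in> X"
    and "\<And>n. (\<lambda>x. f x n) \<in> measurable N (count_space UNIV)"
  shows "f \<in> measurable N (odometer_space q)"
  unfolding odometer_space_def
proof (rule measurable_PiM_single')
  fix n :: nat
  have "(\<lambda>x. f x n) \<in> measurable N (count_space {..<q n})"
  proof (rule measurable_count_space_extend[OF subset_UNIV])
    show "(\<lambda>x. f x n) \<in> space N \<rightarrow> {..<q n}"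
      using assms(1) by (auto intro: digit_less)
  qed (rule assms(2))
  also have "\<dots> = measurable N (uniform_count_measure {..<q n})"
    by (intro measurable_cong_sets) (simp_all add: sets_uniform_count_measure)
  finally show "(\<lambda>x. f x n) \<in> measurable N (uniform_count_measure {..<q n})" .
next
  show "f \<in> space N \<rightarrow> (\<Pi>\<^sub>E i\<in>UNIV. space (uniform_count_measure {..<q i}))"
    using assms(1) by (auto simp: PiE_UNIV_domain space_uniform_count_measure intro: digit_less)
qed

lemma emeasure_digits:
  assumes "a \<in> X"
  shows "emeasure M {x \<in> X. \<forall>k<n. x k = a k} = ennreal (1 / real (place q n))"
proof -
  have eq: "{x \<in> X. \<forall>k<n. x k = a k} =
      prod_emb UNIV (\<lambda>n. uniform_count_measure {..<q n}) {..<n} (\<Pi>\<^sub>E k\<in>{..<n}. {a k})"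
    by (auto simp: prod_emb_def space_odometer PiE_UNIV_domain space_uniform_count_measure
        restrict_def PiE_iff extensional_def)
  have "emeasure M {x \<in> X. \<forall>k<n. x k = a k} =
      (\<Prod>k<n. emeasure (uniform_count_measure {..<q k}) {a k})"
    unfolding eq unfolding odometer_space_def using digit_less[OF assms]
    by (intro emeasure_PiM_emb prob_space_uniform_count_measure)
       (auto simp: lessThan_empty_iff sets_uniform_count_measure)
  also have "\<dots> = (\<Prod>k<n. ennreal (1 / real (q k)))"
    using digit_less[OF assms] by (intro prod.cong) (auto simp: emeasure_uniform_count_measure)
  also have "\<dots> = ennreal (1 / real (place q n))"
    by (simp add: prod_ennreal place_def prod_dividef)
  finally show ?thesis .
qed

lemma exists_trunc:
  assumes "v < place q n"
  obtains a where "a \<in> X" "trunc q n a = v"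
proof
  have 0: "(\<lambda>_. 0) \<in> X" by (simp add: space_odometer)
  have "int (trunc q n (translate q (int v) (\<lambda>_. 0))) = int v"
    using trunc_translate[OF 0, of n "int v"] assms by (simp add: trunc_def)
  then show "trunc q n (translate q (int v) (\<lambda>_. 0)) = v" by simp
qed (rule translate_in_space)

lemma level_eq_digits:
  assumes "a \<in> X"
  shows "{x \<in> X. trunc q n x = trunc q n a} = {x \<in> X. \<forall>k<n. x k = a k}"
  using trunc_eq_iff[OF _ assms] by auto

lemma emeasure_level:
  assumes "v < place q n"
  shows "emeasure M {x \<in> X. trunc q n x = v} = ennreal (1 / real (place q n))"
proof -
  obtain a where "a \<in> X" "trunc q n a = v" using exists_trunc[OF assms] .
  then show ?thesis using emeasure_digits[of a n] level_eq_digits[of a n] by simp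
qed

lemma sets_level [measurable]: "{x \<in> X. trunc q n x = v} \<in> sets M"
  by measurable

text \<open>A condition on the digit \<open>i\<close> is a countable union of levels of depth
  \<open>Suc i\<close>, since the truncation determines that digit.\<close>

lemma sets_odometer_space:
  "sets M = sigma_sets X (range (\<lambda>(n, v). {x \<in> X. trunc q n x = v}))" (is "_ = sigma_sets X ?E")
proof (rule antisym)
  have "{x \<in> X. x i \<in> A} \<in> sigma_sets X ?E" for i A
  proof -
    have "{x \<in> X. x i \<in> A} = (\<Union>v\<in>{v. v div place q i \<in> A}. {x \<in> X. trunc q (Suc i) x = v})"
      by (auto simp: trunc_Suc_div)
    also have "\<dots> \<in> sigma_sets X ?E"
    proof (rule sigma_sets_UNION)
      show "countable ((\<lambda>v. {x \<in> X. trunc q (Suc i) x = v}) ` {v. v div place q i \<in> A})"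
        by (intro countable_image countableI_type)
    qed (auto intro!: sigma_sets.Basic)
    finally show ?thesis .
  qed
  then have "{{f \<in> X. f i \<in> A} |i A. i \<in> UNIV \<and> A \<in> sets (uniform_count_measure {..<q i})}
      \<subseteq> sigma_sets X ?E" by auto
  then show "sets M \<subseteq> sigma_sets X ?E"
    unfolding odometer_space_def sets_PiM_single space_PiM
    by (rule sigma_sets_mono)
  show "sigma_sets X ?E \<subseteq> sets M"
    by (intro sets.sigma_sets_subset) auto
qed

text \<open>Two levels are either nested or disjoint, so the levels are an intersection-stable
  generator, and a measure is determined by its values on them. The level of depth 0 is the whole
  space.\<close>

lemma measure_eq_odometer_space:
  assumes sets: "sets N = sets M"
    and eq: "\<And>n v. v < place q n \<Longrightarrow>
      emeasure N {x \<in> X. trunc q n x = v} = ennreal (1 / real (place q n))"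
  shows "N = M"
proof (rule measure_eqI_generator_eq[where \<Omega> = X and A = "\<lambda>_. {x \<in> X. trunc q 0 x = 0}"
      and E = "range (\<lambda>(n, v). {x \<in> X. trunc q n x = v})"])
  let ?L = "\<lambda>n v. {x \<in> X. trunc q n x = v}"
  have "?L n v \<inter> ?L m w \<in> range (\<lambda>(n, v). ?L n v)" if "m \<le> n" for n v m w
  proof (cases "v mod place q m = w")
    case True
    then have "?L n v \<inter> ?L m w = ?L n v" using trunc_mod[OF _ that] by auto
    then show ?thesis by auto
  next
    case False
    \<comment> \<open>\<open>?L 0 1\<close> is empty, as the truncation at depth 0 is 0; it
      represents the empty intersection inside the generator.\<close>
    then have "?L n v \<inter> ?L m w = ?L 0 1" using trunc_mod[OF _ that] by auto
    then show ?thesis by (simp only: image_eqI[of _ _ "(0, 1)"] case_prod_conv UNIV_I)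
  qed
  then show "Int_stable (range (\<lambda>(n, v). ?L n v))"
    unfolding Int_stable_def by (auto simp del: mem_Collect_eq) (metis (no_types, lifting) Int_commute nat_le_linear)
  fix A assume "A \<in> range (\<lambda>(n, v). ?L n v)"
  then obtain n v where A: "A = ?L n v" by auto
  show "emeasure N A = emeasure M A"
  proof (cases "v < place q n")
    case True
    then show ?thesis by (simp add: A eq emeasure_level)
  next
    case False
    then have "?L n v = {}" using trunc_less by auto
    then show ?thesis by (simp only: A emeasure_empty)
  qed
next
  show "range (\<lambda>_. {x \<in> X. trunc q 0 x = 0}) \<subseteq> range (\<lambda>(n, v). {x \<in> X. trunc q n x = v})"
    by (auto simp del: trunc_0 simp: image_iff)
qed (auto simp: sets sets_odometer_space eq[of 0 0, simplified])

lemma distr_eq_odometer_space: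
  assumes f: "f \<in> measurable N M"
    and eq: "\<And>n v. v < place q n \<Longrightarrow>
      emeasure N {x \<in> space N. trunc q n (f x) = v} = ennreal (1 / real (place q n))"
  shows "distr N M f = M"
proof (rule measure_eq_odometer_space)
  fix n v assume v: "v < place q n"
  have "emeasure (distr N M f) {x \<in> X. trunc q n x = v} =
      emeasure N {x \<in> space N. trunc q n (f x) = v}"
    using measurable_space[OF f]
    by (subst emeasure_distr[OF f]) (auto intro!: arg_cong2[where f = emeasure])
  then show "emeasure (distr N M f) {x \<in> X. trunc q n x = v} = ennreal (1 / real (place q n))"
    using eq[OF v] by simp
qed simp

lemma measurable_translate [measurable]: "translate q k \<in> measurable M M"
proof (rule measurable_into_odometer_space)
  fix n
  show "(\<lambda>x. translate q k x n) \<in> measurable M (count_space UNIV)"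
    unfolding translate_def
    by (rule measurable_compose[OF measurable_trunc]) simp
qed (rule translate_in_space)

lemma level_translate:
  assumes "v < place q n"
  shows "{x \<in> X. trunc q n (translate q k x) = v} =
    {x \<in> X. trunc q n x = nat ((int v - k) mod int (place q n))}"
proof -
  have "trunc q n (translate q k x) = v \<longleftrightarrow> trunc q n x = nat ((int v - k) mod int (place q n))"
    if "x \<in> X" for x
  proof -
    let ?t = "int (trunc q n x)" and ?p = "int (place q n)"
    have t: "?t mod ?p = ?t" using trunc_less[OF that, of n] by simp
    have v: "int v mod ?p = int v" using assms by simp
    have "trunc q n (translate q k x) = v \<longleftrightarrow> (?t + k) mod ?p = int v mod ?p"
      using trunc_translate[OF that, of n k] v by auto
    also have "\<dots> \<longleftrightarrow> ?t mod ?p = (int v - k) mod ?p"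
      by (simp add: mod_eq_dvd_iff algebra_simps)
    also have "\<dots> \<longleftrightarrow> trunc q n x = nat ((int v - k) mod ?p)"
      unfolding t by (auto simp: eq_nat_nat_iff)
    finally show ?thesis .
  qed
  then show ?thesis by auto
qed

lemma distr_translate: "distr M M (translate q k) = M"
proof (rule distr_eq_odometer_space)
  fix n v assume "v < place q n"
  then show "emeasure M {x \<in> X. trunc q n (translate q k x) = v} = ennreal (1 / real (place q n))"
    by (simp add: level_translate emeasure_level nat_less_iff)
qed measurable

lemma emeasure_translate_vimage:
  "A \<in> sets M \<Longrightarrow> emeasure M {x \<in> X. translate q k x \<in> A} = emeasure M A"
  using emeasure_distr[OF measurable_translate, of A k]
  by (simp add: distr_translate vimage_def Int_def conj_commute)

lemma AE_translate:
  assumes "AE x in M. P x"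
  shows "AE x in M. P (translate q k x)"
  by (rule AE_distrD[OF measurable_translate]) (use assms in \<open>simp only: distr_translate\<close>)

lemma null_singleton:
  assumes "y \<in> X"
  shows "{y} \<in> null_sets M"
proof -
  have sub: "{y} = (\<Inter>n. {x \<in> X. trunc q n x = trunc q n y})"
    using assms by (auto intro: eqI_trunc)
  have s: "{y} \<in> sets M"
    unfolding sub by (intro sets.countable_INT) auto
  have "emeasure M {y} \<le> ennreal (1 / 2 ^ n)" for n
  proof -
    have "emeasure M {y} \<le> emeasure M {x \<in> X. trunc q n x = trunc q n y}"
      using assms by (intro emeasure_mono) auto
    also have "\<dots> = ennreal (1 / real (place q n))"
      by (simp add: emeasure_level trunc_less assms)
    also have "\<dots> \<le> ennreal (1 / 2 ^ n)"
    proof -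
      have "real (2 ^ n) \<le> real (place q n)"
        using two_power_le_place by (rule of_nat_mono)
      then show ?thesis by (intro ennreal_leI divide_left_mono) auto
    qed
    finally show ?thesis .
  qed
  moreover have "(\<lambda>n. ennreal (1 / 2 ^ n)) \<longlonglongrightarrow> ennreal 0"
    by (intro tendsto_ennrealI) (simp add: LIMSEQ_divide_realpow_zero)
  ultimately have "emeasure M {y} \<le> ennreal 0"
    by (intro LIMSEQ_le_const) auto
  then show ?thesis using s by (simp add: null_sets_def)
qed

lemma AE_not_in_countable:
  assumes "countable A" "A \<subseteq> X"
  shows "AE x in M. x \<notin> A"
proof -
  have "(\<Union>y\<in>A. {y}) \<in> null_sets M"
    using assms null_singleton by (intro null_sets_UN') auto
  then show ?thesis using AE_not_in by fastforce
qed

text \<open>An invariant set meets all levels of a given depth in equal measure, because translation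
  by 1 permutes these levels cyclically. Conditioning on a non-null invariant set therefore
  reproduces the original measure, which makes the complement null.\<close>

lemma ergodic_translate:
  assumes A [measurable]: "A \<in> sets M"
    and inv: "AE x in M. translate q 1 x \<in> A \<longleftrightarrow> x \<in> A"
  shows "emeasure M A = 0 \<or> (AE x in M. x \<in> A)"
proof (rule disjCI)
  assume "\<not> (AE x in M. x \<in> A)"
  have AX: "A \<subseteq> X" using sets.sets_into_space[OF A] .
  show "emeasure M A = 0"
  proof (rule ccontr)
    assume "emeasure M A \<noteq> 0"
    then have pos: "0 < measure M A"
      by (simp add: emeasure_eq_measure zero_less_measure_iff)
    define L where "L n v = {x \<in> X. trunc q n x = v}" for n v
    have [measurable]: "L n v \<in> sets M" for n v
      by (simp add: L_def)
    \<comment> \<open>Translation by 1 sends the level \<open>v\<close> to the level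
      \<open>Suc v\<close>; staying below \<open>place q n\<close> avoids the wrap-around.\<close>
    have step: "measure M (A \<inter> L n v) = measure M (A \<inter> L n (Suc v))"
      if v: "Suc v < place q n" for n v
    proof -
      have L: "translate q 1 x \<in> L n (Suc v) \<longleftrightarrow> x \<in> L n v" if "x \<in> X" for x
      proof -
        have "nat ((int (Suc v) - 1) mod int (place q n)) = v" using v by simp
        then show ?thesis
          using level_translate[OF v, of 1] that translate_in_space[of 1 x] by (auto simp: L_def set_eq_iff)
      qed
      have "emeasure M {x \<in> X. translate q 1 x \<in> A \<inter> L n (Suc v)} = emeasure M (A \<inter> L n v)"
      proof (rule emeasure_eq_AE)
        show "AE x in M. x \<in> {x \<in> X. translate q 1 x \<in> A \<inter> L n (Suc v)} \<longleftrightarrow> x \<in> A \<inter> L n v"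
          using inv AE_space by eventually_elim (use L in blast)
      qed measurable
      then show ?thesis
        using emeasure_translate_vimage[of "A \<inter> L n (Suc v)" 1]
        by (simp add: emeasure_eq_measure)
    qed
    have level: "real (place q n) * measure M (A \<inter> L n v) = measure M A"
      if "v < place q n" for n v
    proof -
      have const: "w < place q n \<Longrightarrow> measure M (A \<inter> L n w) = measure M (A \<inter> L n 0)" for w
      proof (induction w)
        case (Suc w)
        then show ?case using step[of w n] by simp
      qed simp
      have "measure M (\<Union>w<place q n. A \<inter> L n w) = (\<Sum>w<place q n. measure M (A \<inter> L n w))"
        by (intro finite_measure_finite_Union) (auto simp: disjoint_family_on_def L_def)
      also have "(\<Union>w<place q n. A \<inter> L n w) = A"
        using AX trunc_less by (auto simp: L_def)
      also have "(\<Sum>w<place q n. measure M (A \<inter> L n w)) = (\<Sum>w<place q n. measure M (A \<inter> L n 0))"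
        by (intro sum.cong refl const) simp
      finally show ?thesis using const[OF that] by simp
    qed
    have "uniform_measure M A = M"
    proof (rule measure_eq_odometer_space)
      fix n v assume v: "v < place q n"
      have "emeasure (uniform_measure M A) (L n v) = ennreal (measure M (A \<inter> L n v) / measure M A)"
        using pos by (simp add: emeasure_uniform_measure emeasure_eq_measure divide_ennreal)
      also have "measure M (A \<inter> L n v) / measure M A = 1 / real (place q n)"
        using level[OF v] pos by (simp add: field_simps)
      finally show "emeasure (uniform_measure M A) {x \<in> X. trunc q n x = v} = ennreal (1 / real (place q n))"
        by (simp add: L_def)
    qed simp
    then have "emeasure M (X - A) = emeasure (uniform_measure M A) (X - A)" by simp
    also have "\<dots> = 0"
      by (subst emeasure_uniform_measure) (auto simp: Int_Diff)
    finally have "AE x in M. x \<in> A"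
      by (intro AE_I[of _ _ "X - A"]) auto
    then show False using \<open>\<not> (AE x in M. x \<in> A)\<close> by simp
  qed
qed

text \<open>The countably many fibres of \<open>u\<close> cover the space, so one of them is
  non-null; being invariant, it is conull.\<close>

lemma ergodic_translate_constant:
  fixes u :: "(nat \<Rightarrow> nat) \<Rightarrow> 'c :: countable"
  assumes u [measurable]: "u \<in> measurable M (count_space UNIV)"
    and inv: "AE x in M. u (translate q 1 x) = u x"
  obtains c where "AE x in M. u x = c"
proof -
  let ?A = "\<lambda>c. {x \<in> X. u x = c}"
  have "emeasure M (?A c) = 0 \<or> (AE x in M. x \<in> ?A c)" for c
  proof (rule ergodic_translate)
    show "AE x in M. translate q 1 x \<in> ?A c \<longleftrightarrow> x \<in> ?A c"
      using inv AE_space by eventually_elim (simp add: translate_in_space)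
  qed measurable
  moreover have "\<exists>c. emeasure M (?A c) \<noteq> 0"
  proof (rule ccontr)
    assume "\<nexists>c. emeasure M (?A c) \<noteq> 0"
    then have "(\<Union>c. ?A c) \<in> null_sets M"
      by (intro null_sets_UN) (auto intro: null_setsI)
    moreover have "(\<Union>c. ?A c) = X" by auto
    ultimately show False using emeasure_space_1 by (auto simp: null_sets_def)
  qed
  ultimately obtain c where "AE x in M. x \<in> ?A c" by blast
  then show thesis by (intro that[of c]) auto
qed

end

section \<open>Powers and orbits\<close>

lemma transf_inv_in_space:
  assumes "bij_betw F (space M) (space M)" "x \<in> space M"
  shows "transf_inv M F x \<in> space M"
  using assms unfolding transf_inv_def bij_betw_def by (metis inv_into_into)

lemma transf_inv_right:
  assumes "bij_betw F (space M) (space M)" "x \<in> space M"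
  shows "F (transf_inv M F x) = x"
  using assms unfolding transf_inv_def by (simp add: bij_betw_inv_into_right)

lemma transf_inv_left:
  assumes "bij_betw F (space M) (space M)" "x \<in> space M"
  shows "transf_inv M F (F x) = x"
  using assms unfolding transf_inv_def by (simp add: bij_betw_inv_into_left)

lemma transf_pow_0 [simp]: "transf_pow M F 0 x = x"
  by (simp add: transf_pow_def)

lemma transf_pow_in_space:
  assumes F: "bij_betw F (space M) (space M)" and x: "x \<in> space M"
  shows "transf_pow M F k x \<in> space M"
proof -
  have "(F ^^ n) x \<in> space M" for n
    using x by (induction n) (auto intro: bij_betwE[OF F, rule_format])
  moreover have "(transf_inv M F ^^ n) x \<in> space M" for n
    using x by (induction n) (auto intro: transf_inv_in_space[OF F])
  ultimately show ?thesis by (simp add: transf_pow_def)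
qed

lemma transf_pow_step:
  assumes F: "bij_betw F (space M) (space M)" and x: "x \<in> space M"
  shows "transf_pow M F (k + 1) x = F (transf_pow M F k x)"
proof (cases "0 \<le> k")
  case True
  then show ?thesis by (simp add: transf_pow_def nat_add_distrib)
next
  case False
  define n where "n = nat (- k - 1)"
  have k: "k = - int (Suc n)" using False by (simp add: n_def)
  have "(transf_inv M F ^^ m) x \<in> space M" for m
    using x by (induction m) (auto intro: transf_inv_in_space[OF F])
  then have "F (transf_pow M F k x) = (transf_inv M F ^^ n) x"
    unfolding k transf_pow_def by (simp add: transf_inv_right[OF F] nat_add_distrib)
  also have "\<dots> = transf_pow M F (k + 1) x"
    unfolding k transf_pow_def by simp
  finally show ?thesis by simp
qed

lemma transf_pow_step_back:
  assumes F: "bij_betw F (space M) (space M)" and x: "x \<in> space M"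
  shows "transf_pow M F (k - 1) x = transf_inv M F (transf_pow M F k x)"
  using transf_pow_step[OF assms, of "k - 1"] transf_inv_left[OF F]
    transf_pow_in_space[OF assms, of "k - 1"] by simp

lemma transf_pow_add:
  assumes F: "bij_betw F (space M) (space M)" and x: "x \<in> space M"
  shows "transf_pow M F (j + k) x = transf_pow M F j (transf_pow M F k x)"
proof (induction j rule: int_induct[where k = 0])
  case (step1 j)
  then show ?case
    using transf_pow_step[OF assms, of "j + k"]
      transf_pow_step[OF F transf_pow_in_space[OF assms, of k], of j]
    by (simp add: ac_simps)
next
  case (step2 j)
  then show ?case
    using transf_pow_step_back[OF assms, of "j + k"]
      transf_pow_step_back[OF F transf_pow_in_space[OF assms, of k], of j]
    by (simp add: algebra_simps)
qed simp

lemma transf_pow_of_nat: "transf_pow M F (int n) x = (F ^^ n) x"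
  by (simp add: transf_pow_def)

text \<open>Iterates the inclusion of one step of \<open>F\<close> in the orbits of
  \<open>F'\<close>. In the application \<open>G\<close> is a conull set where this inclusion is
  available, so the induction has to carry along that the iterates remain in
  \<open>G\<close>.\<close>

lemma orbit_of_subset:
  assumes F: "bij_betw F (space M) (space M)" and F': "bij_betw F' (space M) (space M)"
    and G: "G \<subseteq> space M" "\<And>x. x \<in> G \<Longrightarrow> F x \<in> G" "\<And>x. x \<in> G \<Longrightarrow> transf_inv M F x \<in> G"
    and c: "\<And>x. x \<in> G \<Longrightarrow> F x \<in> orbit_of M F' x"
    and x: "x \<in> G"
  shows "transf_pow M F k x \<in> G \<and> transf_pow M F k x \<in> orbit_of M F' x"
proof -
  have xM: "x \<in> space M" using G(1) x by auto
  show ?thesis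
  proof (induction k rule: int_induct[where k = 0])
    case base
    show ?case using x by (auto simp: orbit_of_def intro: range_eqI[of _ _ 0])
  next
    case (step1 k)
    then obtain i where i: "transf_pow M F k x = transf_pow M F' i x"
      by (auto simp: orbit_of_def)
    from c[of "transf_pow M F k x"] step1 obtain j
      where "F (transf_pow M F k x) = transf_pow M F' j (transf_pow M F k x)"
      by (auto simp: orbit_of_def)
    then have "transf_pow M F (k + 1) x = transf_pow M F' (j + i) x"
      by (simp add: transf_pow_step[OF F xM] transf_pow_add[OF F' xM] i)
    moreover have "transf_pow M F (k + 1) x \<in> G"
      using step1 G(2) by (simp add: transf_pow_step[OF F xM])
    ultimately show ?case by (auto simp: orbit_of_def)
  next
    case (step2 k)
    then obtain i where i: "transf_pow M F k x = transf_pow M F' i x"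
      by (auto simp: orbit_of_def)
    \<comment> \<open>For the backward step, the inclusion is applied at the preimage
      \<open>y\<close>, and the resulting power of \<open>F'\<close> is inverted.\<close>
    define y where "y = transf_pow M F (k - 1) x"
    have y: "y \<in> G" "y \<in> space M"
      using step2 G by (auto simp: y_def transf_pow_step_back[OF F xM])
    have Fy: "F y = transf_pow M F' i x"
      using transf_pow_step[OF F xM, of "k - 1"] i by (simp add: y_def)
    from c[OF y(1)] obtain j where "F y = transf_pow M F' j y"
      by (auto simp: orbit_of_def)
    then have "transf_pow M F' (- j) (F y) = y"
      using transf_pow_add[OF F' y(2), of "- j" j] by simp
    then have "y = transf_pow M F' (- j + i) x"
      using transf_pow_add[OF F' xM, of "- j" i] by (simp add: Fy)
    then show ?case using y(1) by (auto simp: orbit_of_def y_def)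
  qed
qed

section \<open>The digit space is standard and atomless, and the odometer is a transformation of
  it\<close>

context mixed_radix
begin

text \<open>The topology is the product of finite discrete ones. The levels form a countable base
  for it and also generate the product sigma-algebra, so the two sigma-algebras coincide.\<close>

lemma standard_borel_odometer_space: "standard_borel_space M"
proof -
  define D where "D = product_topology (\<lambda>n. discrete_topology {..<q n}) (UNIV :: nat set)"
  define L where "L n v = {x \<in> X. trunc q n x = v}" for n v
  have top: "topspace D = X"
    by (auto simp: D_def PiE_UNIV_domain space_odometer Pi_iff)
  have compl: "completely_metrizable_space D"
    unfolding D_def completely_metrizable_space_product_topology
    by (auto simp: completely_metrizable_space_discrete_topology)
  have L_open: "openin D (L n v)" for n v
    unfolding D_def openin_product_topology_alt
  proof
    fix x assume x: "x \<in> L n v"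
    define U where "U k = (if k < n then {x k} else {..<q k})" for k
    have xX: "x \<in> X" using x by (simp add: L_def)
    have "y \<in> L n v" if y: "y \<in> PiE UNIV U" for y
    proof -
      have yU: "y k \<in> U k" for k using y by auto
      have "y k < q k" for k
        using yU[of k] digit_less[OF xX, of k] by (auto simp: U_def split: if_splits)
      moreover have "trunc q n y = trunc q n x"
        using yU unfolding U_def by (intro trunc_cong) (metis singletonD)
      ultimately show ?thesis using x by (simp add: L_def space_odometer)
    qed
    moreover have "finite {i \<in> UNIV. U i \<noteq> topspace (discrete_topology {..<q i})}"
      by (rule finite_subset[of _ "{..<n}"]) (auto simp: U_def split: if_splits)
    ultimately show "\<exists>U. finite {i \<in> UNIV. U i \<noteq> topspace (discrete_topology {..<q i})} \<and>
        (\<forall>i\<in>UNIV. openin (discrete_topology {..<q i}) (U i)) \<and> x \<in> Pi\<^sub>E UNIV U \<and> Pi\<^sub>E UNIV U \<subseteq> L n v"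
      using digit_less[OF xX]
      by (intro exI[of _ U]) (auto simp: U_def split: if_splits)
  qed
  have L_base: "\<exists>n. L n (trunc q n x) \<subseteq> V" if V: "openin D V" "x \<in> V" for V x
  proof -
    have xX: "x \<in> X" using openin_subset[OF V(1)] V(2) top by auto
    obtain U where U: "finite {i. U i \<noteq> {..<q i}}" "x \<in> PiE UNIV U" "PiE UNIV U \<subseteq> V"
      using V unfolding D_def openin_product_topology_alt by auto
    obtain n where n: "{i. U i \<noteq> {..<q i}} \<subseteq> {..<n}"
      using finite_nat_bounded[OF U(1)] by auto
    have "y \<in> PiE UNIV U" if "y \<in> L n (trunc q n x)" for y
    proof -
      have y: "y \<in> X" "trunc q n y = trunc q n x" using that by (auto simp: L_def)
      have "y k \<in> U k" for k
      proof (cases "k < n")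
        case True
        then have "y k = x k" using trunc_eq_iff[OF y(1) xX] y(2) by auto
        then show ?thesis using U(2) by (auto simp: PiE_UNIV_domain)
      next
        case False
        then have "U k = {..<q k}" using n by auto
        then show ?thesis using digit_less[OF y(1)] by auto
      qed
      then show ?thesis by (auto simp: PiE_UNIV_domain)
    qed
    then show ?thesis using U(3) by blast
  qed
  have ctb: "countable (range (\<lambda>(n, v). L n v))"
    by (intro countable_image countableI_type)
  have "second_countable D"
    unfolding second_countable_def
  proof (intro exI[of _ "range (\<lambda>(n, v). L n v)"] conjI ballI allI impI)
    fix V x assume V: "openin D V \<and> x \<in> V"
    then obtain n where "L n (trunc q n x) \<subseteq> V" using L_base by blast
    moreover have "x \<in> L n (trunc q n x)"
      using V openin_subset[of D V] top by (auto simp: L_def)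
    ultimately show "\<exists>W\<in>range (\<lambda>(n, v). L n v). x \<in> W \<and> W \<subseteq> V"
      by (intro bexI[of _ "L n (trunc q n x)"]) auto
  qed (use ctb L_open in auto)
  moreover have "sets M = sigma_sets X {U. openin D U}"
  proof (rule antisym)
    show "sets M \<subseteq> sigma_sets X {U. openin D U}"
      unfolding sets_odometer_space using L_open
      by (intro sigma_sets_mono') (auto simp: L_def)
    have "V \<in> sets M" if V: "openin D V" for V
    proof -
      have "V = \<Union>{W \<in> range (\<lambda>(n, v). L n v). W \<subseteq> V}"
      proof (rule antisym)
        show "V \<subseteq> \<Union>{W \<in> range (\<lambda>(n, v). L n v). W \<subseteq> V}"
        proof
          fix x assume "x \<in> V"
          then obtain n where "L n (trunc q n x) \<subseteq> V" using L_base V by blast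
          moreover have "x \<in> L n (trunc q n x)"
            using \<open>x \<in> V\<close> openin_subset[OF V] top by (auto simp: L_def)
          ultimately show "x \<in> \<Union>{W \<in> range (\<lambda>(n, v). L n v). W \<subseteq> V}" by blast
        qed
      qed blast
      also have "\<dots> \<in> sets M"
        by (rule sets.countable_Union)
           (auto simp: L_def intro: countable_subset[OF _ ctb[unfolded L_def]])
      finally show ?thesis .
    qed
    then show "sigma_sets X {U. openin D U} \<subseteq> sets M"
      by (intro sets.sigma_sets_subset) auto
  qed
  ultimately show ?thesis
    unfolding standard_borel_space_def using top compl by blast
qed

lemma emeasure_level_le:
  "emeasure M {x \<in> X. trunc q n x = v} \<le> ennreal (1 / real (place q n))"
proof (cases "v < place q n")
  case False
  then have "{x \<in> X. trunc q n x = v} = {}" using trunc_less by auto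
  then show ?thesis by (simp only: emeasure_empty zero_le)
qed (simp add: emeasure_level)

text \<open>At a depth where every level is lighter than \<open>A\<close>, some level meets
  \<open>A\<close> in positive measure, and this intersection is the subset wanted.\<close>

lemma atomless_odometer_space: "atomless M"
  unfolding atomless_def
proof (intro ballI impI)
  fix A assume A [measurable]: "A \<in> sets M" and pos: "0 < emeasure M A"
  define L where "L n v = {x \<in> X. trunc q n x = v}" for n v
  have [measurable]: "L n v \<in> sets M" for n v by (simp add: L_def)
  from pos have a: "0 < measure M A"
    by (simp add: emeasure_eq_measure)
  obtain n where n: "1 / measure M A < 2 ^ n"
    using real_arch_pow[of 2 "1 / measure M A"] by auto
  then have "1 / 2 ^ n < measure M A"
    using a by (simp add: field_simps)
  moreover have "1 / real (place q n) \<le> 1 / 2 ^ n"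
    using of_nat_mono[OF two_power_le_place, of n, where 'a = real]
    by (intro divide_left_mono) auto
  ultimately have small: "1 / real (place q n) < measure M A" by simp
  have "\<exists>v. emeasure M (A \<inter> L n v) \<noteq> 0"
  proof (rule ccontr)
    assume "\<nexists>v. emeasure M (A \<inter> L n v) \<noteq> 0"
    then have "(\<Union>v. A \<inter> L n v) \<in> null_sets M"
      by (intro null_sets_UN) auto
    moreover have "(\<Union>v. A \<inter> L n v) = A"
      using sets.sets_into_space[OF A] by (auto simp: L_def)
    ultimately show False using pos by (simp add: null_sets_def)
  qed
  then obtain v where v: "emeasure M (A \<inter> L n v) \<noteq> 0" by blast
  have "emeasure M (A \<inter> L n v) \<le> ennreal (1 / real (place q n))"
    using emeasure_mono[of "A \<inter> L n v" "L n v" M] emeasure_level_le[of n v]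
    by (simp add: L_def)
  also have "\<dots> < emeasure M A"
    using small by (simp add: emeasure_eq_measure ennreal_lessI a)
  finally show "\<exists>B\<in>sets M. B \<subseteq> A \<and> 0 < emeasure M B \<and> emeasure M B < emeasure M A"
    using v by (intro bexI[of _ "A \<inter> L n v"]) (auto simp: zero_less_iff_neq_zero)
qed

lemma standard_atomless_odometer_space: "standard_atomless_prob_space M"
  unfolding standard_atomless_prob_space_def
  using prob_space_axioms standard_borel_odometer_space atomless_odometer_space by blast

text \<open>As \<^term>\<open>T\<close> is bijective, the translates of the pieces where the cocycle is constant
  partition the space again.\<close>

lemma mp_bijection_piecewise_translate:
  assumes c [measurable]: "c \<in> measurable M (count_space (UNIV :: int set))"
    and T: "\<And>x. x \<in> X \<Longrightarrow> T x = translate q (c x) x" and bij: "bij_betw T X X"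
  shows "mp_bijection M M T"
proof -
  have "(\<lambda>x. translate q (c x) x) \<in> measurable M M"
    by (rule measurable_compose_countable) measurable
  then have m [measurable]: "T \<in> measurable M M"
    by (rule measurable_cong[THEN iffD2, rotated]) (simp add: T)
  \<comment> \<open>The piece of \<open>A\<close> on which the cocycle is \<open>k\<close>, moved by
    \<open>k\<close>.\<close>
  let ?P = "\<lambda>A k. {y \<in> X. translate q (- k) y \<in> {x \<in> A. c x = k}}"
  have s [measurable]: "{x \<in> A. c x = k} \<in> sets M" if [measurable]: "A \<in> sets M" for A k
  proof -
    have "{x \<in> A. c x = k} = A \<inter> {x \<in> X. c x = k}"
      using sets.sets_into_space[OF that] by auto
    then show ?thesis by simp
  qed
  have image: "T ` A = (\<Union>k. ?P A k)" if "A \<subseteq> X" for A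
  proof (intro set_eqI iffI)
    fix y assume "y \<in> T ` A"
    then obtain x where x: "x \<in> A" "y = T x" by auto
    then have "y \<in> ?P A (c x)"
      using that T[of x] by (auto simp: translate_in_space)
    then show "y \<in> (\<Union>k. ?P A k)" by blast
  next
    fix y assume "y \<in> (\<Union>k. ?P A k)"
    then obtain k where y: "y \<in> X" "translate q (- k) y \<in> A" "c (translate q (- k) y) = k" by auto
    then have "T (translate q (- k) y) = y"
      using that T[of "translate q (- k) y"] by (auto simp: translate_in_space)
    then show "y \<in> T ` A" using y(2) by force
  qed
  have image_sets: "T ` A \<in> sets M" if [measurable]: "A \<in> sets M" for A
  proof -
    have [measurable]: "?P A k \<in> sets M" for k
      using that by measurable
    show ?thesis
      unfolding image[OF sets.sets_into_space[OF that]] by measurable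
  qed
  have "inv_into X T \<in> measurable M M"
  proof (rule measurableI)
    fix x assume "x \<in> X"
    then show "inv_into X T x \<in> X"
      using bij by (metis bij_betw_def inv_into_into)
  next
    fix A assume A: "A \<in> sets M"
    have "inv_into X T -` A \<inter> X = T ` A"
    proof (intro set_eqI iffI)
      fix y assume y: "y \<in> inv_into X T -` A \<inter> X"
      then have "T (inv_into X T y) = y" using bij by (simp add: bij_betw_inv_into_right)
      then show "y \<in> T ` A" using y by force
    next
      fix y assume "y \<in> T ` A"
      then show "y \<in> inv_into X T -` A \<inter> X"
        using bij sets.sets_into_space[OF A] bij_betwE[OF bij]
        by (auto simp: bij_betw_inv_into_left subset_eq)
    qed
    then show "inv_into X T -` A \<inter> X \<in> sets M" using image_sets[OF A] by simp
  qed
  moreover have "distr M M T = M"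
  proof (rule measure_eqI)
    fix B assume "B \<in> sets (distr M M T)"
    then have B [measurable]: "B \<in> sets M" by simp
    \<comment> \<open>Measure preservation compares the preimage \<open>A\<close> of
      \<open>B\<close> with its image \<open>B\<close>: \<open>A\<close> is cut into pieces of
      constant cocycle, and each piece is moved by a measure-preserving translation. Injectivity of
      \<open>T\<close> keeps the moved pieces disjoint.\<close>
    define A where "A = {x \<in> X. T x \<in> B}"
    have A [measurable]: "A \<in> sets M" unfolding A_def by measurable
    have "T ` A = B"
      using bij sets.sets_into_space[OF B] unfolding A_def bij_betw_def by (auto simp: subset_eq image_iff)
    have P [measurable]: "?P A k \<in> sets M" for k
      by measurable
    have "emeasure (distr M M T) B = emeasure M A"
      by (subst emeasure_distr) (auto simp: A_def intro!: arg_cong2[where f = emeasure])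
    also have "A = (\<Union>k. {x \<in> A. c x = k})" by auto
    also have "emeasure M \<dots> = (\<integral>\<^sup>+k. emeasure M {x \<in> A. c x = k} \<partial>count_space UNIV)"
      by (intro emeasure_UN_countable) (auto simp: disjoint_family_on_def s)
    also have "\<dots> = (\<integral>\<^sup>+k. emeasure M (?P A k) \<partial>count_space UNIV)"
      by (intro nn_integral_cong) (simp only: emeasure_translate_vimage[OF s[OF A]])
    also have "\<dots> = emeasure M (\<Union>k. ?P A k)"
    proof (intro emeasure_UN_countable[symmetric])
      show "disjoint_family_on (?P A) UNIV"
        unfolding disjoint_family_on_def
      proof (intro ballI impI, rule ccontr)
        fix j k :: int assume "j \<noteq> k" "?P A j \<inter> ?P A k \<noteq> {}"
        then obtain y where y: "y \<in> ?P A j" "y \<in> ?P A k" by blast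
        then have "T (translate q (- j) y) = T (translate q (- k) y)"
          using T by (auto simp: A_def)
        then have "translate q (- j) y = translate q (- k) y"
          using bij y by (auto simp: bij_betw_def inj_on_def A_def)
        then have "j = k" using y by auto
        then show False using \<open>j \<noteq> k\<close> by simp
      qed
    qed auto
    also have "(\<Union>k. ?P A k) = B"
      using image[of A] \<open>T ` A = B\<close> by (auto simp: A_def)
    finally show "emeasure (distr M M T) B = emeasure M B" .
  qed simp
  ultimately show ?thesis
    unfolding mp_bijection_def using bij m by blast
qed

lemma bij_betw_translate: "bij_betw (translate q k) X X"
  by (rule bij_betw_byWitness[where f' = "translate q (- k)"]) (auto simp: translate_in_space)

lemma bij_betw_odometer: "bij_betw (odometer q) X X"
  using bij_betw_translate[of 1] by (rule bij_betw_cong[THEN iffD2, rotated]) (rule odometer_eq_translate)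

lemma mp_bijection_odometer: "mp_bijection M M (odometer q)"
  using bij_betw_odometer odometer_eq_translate
  by (intro mp_bijection_piecewise_translate[of "\<lambda>_. 1"]) auto

lemma transf_inv_odometer:
  assumes "x \<in> X"
  shows "transf_inv M (odometer q) x = translate q (- 1) x"
  using transf_inv_left[OF bij_betw_odometer translate_in_space, of "- 1" x]
    odometer_eq_translate[OF translate_in_space, of "- 1" x] assms by simp

lemma transf_pow_odometer:
  assumes "x \<in> X"
  shows "transf_pow M (odometer q) k x = translate q k x"
proof (induction k rule: int_induct[where k = 0])
  case (step1 k)
  then show ?case
    using transf_pow_step[OF bij_betw_odometer assms, of k] assms
    by (simp add: odometer_eq_translate translate_in_space translate_translate ac_simps)
next
  case (step2 k)
  then show ?case
    using transf_pow_step_back[OF bij_betw_odometer assms, of k] assms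
    by (simp add: transf_inv_odometer translate_in_space translate_translate)
qed (simp add: assms)

lemma orbit_of_odometer: "x \<in> X \<Longrightarrow> orbit_of M (odometer q) x = range (\<lambda>k. translate q k x)"
  by (simp add: orbit_of_def transf_pow_odometer)

lemma aperiodic_odometer: "aperiodic M (odometer q)"
  unfolding aperiodic_def
  using transf_pow_odometer translate_fixed_point
  by (intro AE_I2) (metis of_nat_0_less_iff less_irrefl transf_pow_of_nat)

lemma pmp_transformation_odometer: "pmp_transformation M (odometer q)"
  using standard_atomless_odometer_space mp_bijection_odometer
  by (simp add: pmp_transformation_def)

end

section \<open>Twisting digits\<close>

text \<open>The largest digit of an odd radix has no partner and is fixed.\<close>

definition swap_pair :: "nat \<Rightarrow> nat \<Rightarrow> nat" where
  "swap_pair m v = (if even v then (if Suc v < m then Suc v else v) else v - 1)"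

definition cond_swap :: "nat \<Rightarrow> nat \<Rightarrow> nat \<Rightarrow> nat" where
  "cond_swap m b v = (if odd b then swap_pair m v else v)"

lemma swap_pair_less: "v < m \<Longrightarrow> swap_pair m v < m"
  by (auto simp: swap_pair_def)

lemma swap_pair_involution [simp]: "v < m \<Longrightarrow> swap_pair m (swap_pair m v) = v"
  by (auto simp: swap_pair_def elim: oddE)

lemma cond_swap_less: "v < m \<Longrightarrow> cond_swap m b v < m"
  by (simp add: cond_swap_def swap_pair_less)

lemma cond_swap_involution [simp]: "v < m \<Longrightarrow> cond_swap m b (cond_swap m b v) = v"
  by (simp add: cond_swap_def)

text \<open>A swap moves a digit by at most 1, so neighbours end at distance at most 1 + 1 + 1. The
  same \<open>b\<close> on both sides reflects that the next digit is common to both points.\<close>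

lemma cond_swap_Suc_close: "\<bar>int (cond_swap m b (Suc v)) - int (cond_swap m b v)\<bar> \<le> 3"
  by (auto simp: cond_swap_def swap_pair_def)

text \<open>This is the map \<psi> of the introduction.\<close>

definition twist :: "(nat \<Rightarrow> nat) \<Rightarrow> (nat \<Rightarrow> nat) \<Rightarrow> nat \<Rightarrow> nat" where
  "twist q x = (\<lambda>n. cond_swap (q n) (x (Suc n)) (x n))"

text \<open>The point with the digits of \<^term>\<open>x\<close> from \<^term>\<open>n\<close> on whose twist has the digits of \<^term>\<open>y\<close>
  below \<^term>\<open>n\<close>.\<close>

primrec untwist :: "(nat \<Rightarrow> nat) \<Rightarrow> nat \<Rightarrow> (nat \<Rightarrow> nat) \<Rightarrow> (nat \<Rightarrow> nat) \<Rightarrow> nat \<Rightarrow> nat" where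
  "untwist q 0 y x = x"
| "untwist q (Suc n) y x = untwist q n y (x(n := cond_swap (q n) (x (Suc n)) (y n)))"

definition same_tail :: "(nat \<Rightarrow> 'a) \<Rightarrow> (nat \<Rightarrow> 'a) \<Rightarrow> bool" where
  "same_tail x y \<longleftrightarrow> (\<exists>m. \<forall>k\<ge>m. x k = y k)"

lemma same_tail_refl [simp]: "same_tail x x"
  by (simp add: same_tail_def)

lemma same_tail_sym: "same_tail x y \<Longrightarrow> same_tail y x"
  unfolding same_tail_def by metis

lemma same_tail_trans: "same_tail x y \<Longrightarrow> same_tail y z \<Longrightarrow> same_tail x z"
  unfolding same_tail_def by (metis max.bounded_iff)

lemma same_tail_twist: "same_tail x y \<Longrightarrow> same_tail (twist q x) (twist q y)"
  unfolding same_tail_def twist_def by (metis le_SucI)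

lemma untwist_above: "n \<le> k \<Longrightarrow> untwist q n y x k = x k"
  by (induction n arbitrary: x) auto

lemma twist_untwist_above: "n \<le> k \<Longrightarrow> twist q (untwist q n y x) k = twist q x k"
  by (simp add: twist_def untwist_above)

text \<open>The recursion descends from \<open>n\<close>, and each new digit depends on
  \<open>y\<close> and on the digit just above it, so the digit \<open>n\<close> of the seed
  determines everything below.\<close>

lemma untwist_local: "x n = x' n \<Longrightarrow> k \<le> n \<Longrightarrow> untwist q n y x k = untwist q n y x' k"
proof (induction n arbitrary: x x')
  case (Suc n)
  show ?case
  proof (cases "k \<le> n")
    case True
    then show ?thesis using Suc.prems(1) by (auto intro!: Suc.IH)
  next
    case False
    then have "k = Suc n" using Suc.prems(2) by simp
    then show ?thesis using Suc.prems(1) by (simp add: untwist_above)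
  qed
qed simp

context mixed_radix
begin

lemma twist_in_space: "x \<in> X \<Longrightarrow> twist q x \<in> X"
  by (simp add: space_odometer twist_def cond_swap_less)

lemma untwist_in_space: "x \<in> X \<Longrightarrow> y \<in> X \<Longrightarrow> untwist q n y x \<in> X"
proof (induction n arbitrary: x)
  case (Suc n)
  then have "x(n := cond_swap (q n) (x (Suc n)) (y n)) \<in> X"
    by (simp add: space_odometer cond_swap_less)
  then show ?case using Suc by simp
qed simp

lemma twist_untwist_below: "y \<in> X \<Longrightarrow> k < n \<Longrightarrow> twist q (untwist q n y x) k = y k"
proof (induction n arbitrary: x)
  case (Suc n)
  show ?case
  proof (cases "k < n")
    case True
    then show ?thesis using Suc by simp
  next
    case False
    then have "k = n" using Suc.prems by simp
    then show ?thesis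
      using digit_less[OF \<open>y \<in> X\<close>] by (simp add: twist_def untwist_above)
  qed
qed simp

lemma untwist_twist: "x \<in> X \<Longrightarrow> (\<And>k. k < n \<Longrightarrow> twist q x k = y k) \<Longrightarrow> untwist q n y x = x"
proof (induction n)
  case (Suc n)
  have "cond_swap (q n) (x (Suc n)) (y n) = x n"
  proof -
    have "y n = cond_swap (q n) (x (Suc n)) (x n)"
      using Suc.prems(2)[of n] by (simp add: twist_def)
    then show ?thesis using digit_less[OF \<open>x \<in> X\<close>] by simp
  qed
  then show ?case using Suc by (simp add: fun_upd_idem)
qed simp

text \<open>Downward induction from the common tail: once the next digits agree, both current digits
  undergo the same involution.\<close>

lemma twist_eq_imp_eq_above:
  assumes "x \<in> X" "x' \<in> X" "same_tail x x'" and eq: "\<And>k. n \<le> k \<Longrightarrow> twist q x k = twist q x' k"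
    and "n \<le> k"
  shows "x k = x' k"
proof -
  obtain m where m: "\<And>k. m \<le> k \<Longrightarrow> x k = x' k"
    using assms(3) by (auto simp: same_tail_def)
  have "x k = x' k" if "n \<le> k" "k \<le> max m n" for k
    using that(2,1)
  proof (induction k rule: inc_induct)
    case (step k)
    then have "cond_swap (q k) (x (Suc k)) (x k) = cond_swap (q k) (x (Suc k)) (x' k)"
      using eq[of k] by (simp add: twist_def)
    then show ?case using digit_less[OF assms(1), of k] digit_less[OF assms(2), of k]
      by (metis cond_swap_involution)
  qed (simp add: m)
  then show ?thesis using m[of k] assms(5) by (cases "k \<le> max m n") auto
qed

lemma twist_inj_on_tails:
  assumes "x \<in> X" "x' \<in> X" "same_tail x x'" "twist q x = twist q x'"
  shows "x = x'"
  using twist_eq_imp_eq_above[of x x' 0] assms by auto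

text \<open>The preimage keeps the digits of \<open>x\<close> where \<open>y\<close> already agrees
  with the twist of \<open>x\<close>, and is untwisted from \<open>y\<close> below.\<close>

lemma twist_surj_on_tails:
  assumes "x \<in> X" "y \<in> X" "same_tail y (twist q x)"
  obtains x' where "x' \<in> X" "same_tail x' x" "twist q x' = y"
proof -
  obtain m where m: "\<And>k. m \<le> k \<Longrightarrow> y k = twist q x k"
    using assms(3) by (auto simp: same_tail_def)
  have "same_tail (untwist q m y x) x"
    by (auto simp: same_tail_def intro: untwist_above)
  moreover have "twist q (untwist q m y x) k = y k" for k
    using twist_untwist_below[OF assms(2)] twist_untwist_above[of m k] m by (cases "k < m") auto
  ultimately show thesis
    using untwist_in_space assms by (intro that[of "untwist q m y x"]) auto
qed

lemma measurable_twist [measurable]: "twist q \<in> measurable M M"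
proof (rule measurable_into_odometer_space)
  fix n
  show "(\<lambda>x. twist q x n) \<in> measurable M (count_space UNIV)"
    unfolding twist_def
    by (rule measurable_compose_countable[OF measurable_compose[OF measurable_digit]]) simp_all
qed (rule twist_in_space)

text \<open>The preimage of a cylinder of length \<open>n\<close> is a disjoint union of
  \<open>q n\<close> cylinders of length \<open>Suc n\<close>: each value \<open>b\<close> of the
  digit \<open>n\<close> seeds one untwisting \<open>w b\<close>.\<close>

lemma distr_twist: "distr M M (twist q) = M"
proof (rule distr_eq_odometer_space)
  fix n v assume v: "v < place q n"
  obtain a where a: "a \<in> X" "trunc q n a = v" using exists_trunc[OF v] .
  define w where "w b = untwist q n a (a(n := b))" for b
  have wX: "w b \<in> X" if "b < q n" for b
    unfolding w_def using a(1) that by (intro untwist_in_space) (auto simp: space_odometer)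
  have "{x \<in> X. trunc q n (twist q x) = v} = {x \<in> X. \<forall>k<n. twist q x k = a k}"
    using trunc_eq_iff[OF twist_in_space a(1), of _ n] a(2) by auto
  also have "\<dots> = (\<Union>b<q n. {x \<in> X. \<forall>k<Suc n. x k = w b k})"
  proof (intro set_eqI iffI)
    fix x assume "x \<in> {x \<in> X. \<forall>k<n. twist q x k = a k}"
    then have x: "x \<in> X" "\<And>k. k < n \<Longrightarrow> twist q x k = a k" by auto
    have "x k = w (x n) k" if "k < Suc n" for k
      using untwist_local[of x n "a(n := x n)" k q a] that untwist_twist[OF x, of n]
      by (simp add: w_def)
    then show "x \<in> (\<Union>b<q n. {x \<in> X. \<forall>k<Suc n. x k = w b k})"
      using x(1) digit_less[OF x(1), of n] by blast
  next
    fix x assume "x \<in> (\<Union>b<q n. {x \<in> X. \<forall>k<Suc n. x k = w b k})"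
    then obtain b where b: "b < q n" "x \<in> X" "\<forall>k<Suc n. x k = w b k" by blast
    have "twist q x k = a k" if "k < n" for k
      using b(3) that twist_untwist_below[OF a(1) that, of "a(n := b)"]
      by (simp add: twist_def w_def)
    then show "x \<in> {x \<in> X. \<forall>k<n. twist q x k = a k}" using b(2) by simp
  qed
  also have "emeasure M \<dots> = (\<Sum>b<q n. emeasure M {x \<in> X. \<forall>k<Suc n. x k = w b k})"
  proof (intro sum_emeasure[symmetric])
    show "(\<lambda>b. {x \<in> X. \<forall>k<Suc n. x k = w b k}) ` {..<q n} \<subseteq> sets M"
      by auto
    have "w b n = b" for b by (simp add: w_def untwist_above)
    then show "disjoint_family_on (\<lambda>b. {x \<in> X. \<forall>k<Suc n. x k = w b k}) {..<q n}"
      unfolding disjoint_family_on_def by (auto simp: disjoint_iff)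
  qed simp
  also have "\<dots> = (\<Sum>b<q n. ennreal (1 / real (place q (Suc n))))"
    by (intro sum.cong refl emeasure_digits wX) simp
  also have "\<dots> = ennreal (real (q n) * (1 / real (place q (Suc n))))"
    by (subst ennreal_mult) (simp_all add: ennreal_of_nat_eq_real_of_nat)
  also have "real (q n) * (1 / real (place q (Suc n))) = 1 / real (place q n)"
    using q_pos[of n] by (simp add: place_Suc)
  finally show "emeasure M {x \<in> X. trunc q n (twist q x) = v} = ennreal (1 / real (place q n))" .
qed measurable

text \<open>These are the sequences that end in zeros or in maximal digits, the only ones where the
  orbit is not the tail class.\<close>

abbreviation "zero_orbit \<equiv> range (\<lambda>k. translate q k (\<lambda>_. 0))"

lemma zero_in_space: "(\<lambda>_. 0) \<in> X"
  by (simp add: space_odometer)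

lemma zero_orbit_in_space: "zero_orbit \<subseteq> X"
  by (auto simp: translate_in_space)

lemma zero_orbit_translate:
  assumes "y \<in> X"
  shows "translate q k y \<in> zero_orbit \<longleftrightarrow> y \<in> zero_orbit"
proof
  assume "translate q k y \<in> zero_orbit"
  then obtain j where "translate q k y = translate q j (\<lambda>_. 0)" by auto
  then have "y = translate q (- k) (translate q j (\<lambda>_. 0))"
    using assms by (metis translate_inverse(2))
  then show "y \<in> zero_orbit"
    by (auto simp: translate_translate zero_in_space)
qed (auto simp: translate_translate zero_in_space)

lemma zero_orbit_same_tail:
  assumes "x \<in> X" "y \<in> X" "same_tail x y"
  shows "x \<in> zero_orbit \<longleftrightarrow> y \<in> zero_orbit"
proof -
  obtain m where "\<And>k. m \<le> k \<Longrightarrow> x k = y k"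
    using assms(3) by (auto simp: same_tail_def)
  from eq_translate_if_same_tail[OF assms(1,2) this] show ?thesis
    using zero_orbit_translate[OF assms(1)] by metis
qed

text \<open>If all digits were maximal, adding 1 would give the zero sequence, and the point would
  lie in \<open>zero_orbit\<close>. The carry stops at the least digit that is not maximal.\<close>

lemma carry_stops:
  assumes "x \<in> X" "x \<notin> zero_orbit"
  obtains n where "\<And>k. k < n \<Longrightarrow> x k = q k - 1" "Suc (x n) < q n"
proof -
  have "\<exists>n. x n \<noteq> q n - 1"
  proof (rule ccontr)
    assume "\<nexists>n. x n \<noteq> q n - 1"
    then have "trunc q n x + 1 = place q n" for n
      by (intro trunc_max_digits) auto
    then have "int (trunc q n x) + 1 = int (place q n)" for n
      by (metis of_nat_1 of_nat_add)
    moreover have "trunc q n (\<lambda>_. 0) = 0" for n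
      by (simp add: trunc_def)
    ultimately have "translate q 1 x = (\<lambda>_. 0)"
      by (intro eqI_int_trunc[OF translate_in_space zero_in_space, of 0])
         (simp add: trunc_translate[OF assms(1)])
    then have "translate q 1 x \<in> zero_orbit"
      using translate_0[OF zero_in_space] by (metis rangeI)
    then show False using zero_orbit_translate assms by blast
  qed
  define n where "n = (LEAST n. x n \<noteq> q n - 1)"
  have "x n \<noteq> q n - 1" unfolding n_def using \<open>\<exists>n. x n \<noteq> q n - 1\<close> by (rule LeastI_ex)
  then have "Suc (x n) < q n" using digit_less[OF assms(1), of n] by simp
  moreover have "x k = q k - 1" if "k < n" for k
    using not_less_Least[of k] that unfolding n_def by auto
  ultimately show thesis using that by blast
qed

text \<open>A unit step changes only the digits up to where the carry stops. Invariance of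
  \<open>zero_orbit\<close> lets this be repeated in both directions.\<close>

lemma same_tail_translate:
  assumes "x \<in> X" "x \<notin> zero_orbit"
  shows "same_tail (translate q k x) x"
proof -
  have step: "same_tail (translate q 1 y) y" if y: "y \<in> X" "y \<notin> zero_orbit" for y
  proof -
    obtain n where "\<And>k. k < n \<Longrightarrow> y k = q k - 1" "Suc (y n) < q n"
      using carry_stops[OF y] by blast
    then show ?thesis
      using translate_1_carry[OF y(1), of n] by (auto simp: same_tail_def intro!: exI[of _ "Suc n"])
  qed
  have bwd: "same_tail (translate q (- 1) y) y" if y: "y \<in> X" "y \<notin> zero_orbit" for y
    using step[OF translate_in_space, of "- 1" y] zero_orbit_translate[OF y(1)] y
    by (auto intro: same_tail_sym)
  show ?thesis
  proof (induction k rule: int_induct[where k = 0])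
    case (step1 k)
    have "same_tail (translate q 1 (translate q k x)) (translate q k x)"
      using assms zero_orbit_translate by (intro step translate_in_space) auto
    then show ?case
      using step1 assms(1) by (auto simp: translate_translate ac_simps intro: same_tail_trans)
  next
    case (step2 k)
    have "same_tail (translate q (- 1) (translate q k x)) (translate q k x)"
      using assms zero_orbit_translate by (intro bwd translate_in_space) auto
    then show ?case
      using step2 assms(1) by (auto simp: translate_translate intro: same_tail_trans)
  qed (simp add: assms)
qed

section \<open>The transformation with the orbits of the odometer, and the two cocycles\<close>

definition good :: "(nat \<Rightarrow> nat) set" where
  "good = {x \<in> X. x \<notin> zero_orbit \<and> twist q x \<notin> zero_orbit}"

text \<open>The choice is unique on \<open>good\<close>, by injectivity of the twist on tail
  classes. The value 0 elsewhere makes \<open>mutation\<close> the identity there, so that it is a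
  bijection of the whole space.\<close>

definition mutation_cocycle :: "(nat \<Rightarrow> nat) \<Rightarrow> int" where
  "mutation_cocycle x =
     (if x \<in> good then SOME k. twist q (translate q k x) = translate q 1 (twist q x) else 0)"

text \<open>This is the map \<open>T\<close> of the introduction.\<close>

definition mutation :: "(nat \<Rightarrow> nat) \<Rightarrow> nat \<Rightarrow> nat" where
  "mutation x = translate q (mutation_cocycle x) x"

text \<open>The twist turns powers of \<open>mutation\<close> into powers of translation by 1. The
  exponent that writes the odometer as a power of \<open>mutation\<close> can therefore be read off
  after twisting.\<close>

definition odometer_cocycle :: "(nat \<Rightarrow> nat) \<Rightarrow> int" where
  "odometer_cocycle x =
     (if x \<in> good then SOME k. translate q k (twist q x) = twist q (translate q 1 x) else 0)"

lemma good_in_space: "x \<in> good \<Longrightarrow> x \<in> X"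
  by (simp add: good_def)

lemma good_same_tail:
  assumes "x \<in> good" "y \<in> X" "same_tail y x"
  shows "y \<in> good"
  using assms zero_orbit_same_tail[of y x]
    zero_orbit_same_tail[OF twist_in_space twist_in_space same_tail_twist, of y x]
  by (simp add: good_def)

lemma AE_good: "AE x in M. x \<in> good"
proof -
  have "AE x in M. x \<notin> zero_orbit"
    by (intro AE_not_in_countable zero_orbit_in_space) simp
  moreover from this have "AE x in M. twist q x \<notin> zero_orbit"
    by (intro AE_distrD[OF measurable_twist]) (simp only: distr_twist)
  ultimately show ?thesis
    using AE_space by eventually_elim (simp add: good_def)
qed

lemma same_tail_translate_good: "x \<in> good \<Longrightarrow> same_tail (translate q k x) x"
  by (simp add: good_def same_tail_translate)

lemma translate_good: "x \<in> good \<Longrightarrow> translate q k x \<in> good"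
  using good_same_tail same_tail_translate_good translate_in_space by blast

lemma twist_translate_inj:
  assumes "x \<in> good" "twist q (translate q j x) = twist q (translate q k x)"
  shows "j = k"
  using assms same_tail_translate_good[OF assms(1)] good_in_space[OF assms(1)]
  by (meson same_tail_sym same_tail_trans translate_in_space translate_inj twist_inj_on_tails)

lemma exists_translate_of_twist:
  assumes "x \<in> good" "y \<in> X" "same_tail y (twist q x)"
  obtains k where "twist q (translate q k x) = y"
proof -
  obtain x' where x': "x' \<in> X" "same_tail x' x" "twist q x' = y"
    using twist_surj_on_tails[OF good_in_space] assms by metis
  then obtain m where "\<forall>k\<ge>m. x' k = x k"
    unfolding same_tail_def by blast
  then have "x' = translate q (int (trunc q m x') - int (trunc q m x)) x"
    using eq_translate_if_same_tail[OF good_in_space[OF assms(1)] x'(1), of m] by simp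
  then show thesis using x'(3) that by metis
qed

text \<open>Since \<open>twist q x\<close> is outside \<open>zero_orbit\<close>, adding 1 keeps its
  tail, and surjectivity of the twist on tail classes supplies the integer chosen by
  \<open>SOME\<close>.\<close>

lemma twist_mutation:
  assumes "x \<in> good"
  shows "twist q (mutation x) = translate q 1 (twist q x)"
proof -
  have "same_tail (translate q 1 (twist q x)) (twist q x)"
    using assms by (intro same_tail_translate) (auto simp: good_def twist_in_space)
  then obtain k where "twist q (translate q k x) = translate q 1 (twist q x)"
    using exists_translate_of_twist[OF assms translate_in_space] by metis
  then show ?thesis
    unfolding mutation_def mutation_cocycle_def using assms
    by (simp only: if_True) (rule someI)
qed

lemma mutation_cocycle_eq_iff:
  assumes "x \<in> good"
  shows "mutation_cocycle x = k \<longleftrightarrow> twist q (translate q k x) = translate q 1 (twist q x)"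
  using twist_mutation[OF assms] twist_translate_inj[OF assms] unfolding mutation_def by metis

lemma mutation_in_space: "mutation x \<in> X"
  by (simp add: mutation_def translate_in_space)

lemma same_tail_mutation: "x \<in> good \<Longrightarrow> same_tail (mutation x) x"
  by (simp add: mutation_def same_tail_translate_good)

lemma mutation_good: "x \<in> good \<Longrightarrow> mutation x \<in> good"
  by (simp add: mutation_def translate_good)

lemma mutation_not_good: "x \<in> X \<Longrightarrow> x \<notin> good \<Longrightarrow> mutation x = x"
  by (simp add: mutation_def mutation_cocycle_def)

lemma mutation_preimage:
  assumes "x \<in> good"
  obtains z where "z \<in> good" "mutation z = x" "twist q z = translate q (- 1) (twist q x)"
proof -
  have X: "x \<in> X" "twist q x \<in> X" using assms by (auto simp: good_def twist_in_space)
  have "same_tail (translate q (- 1) (twist q x)) (twist q x)"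
    using assms X by (intro same_tail_translate) (auto simp: good_def)
  then obtain z where z: "z \<in> X" "same_tail z x" "twist q z = translate q (- 1) (twist q x)"
    using twist_surj_on_tails[OF X(1) translate_in_space] by metis
  then have good: "z \<in> good" using good_same_tail assms by blast
  have "twist q (mutation z) = twist q x"
    using twist_mutation[OF good] z(3) X by simp
  then have "mutation z = x"
    using same_tail_mutation[OF good] z(2) X(1) mutation_in_space
    by (meson same_tail_trans twist_inj_on_tails)
  then show thesis using that good z(3) by blast
qed

text \<open>\<open>mutation\<close> maps \<open>good\<close> to itself and is the identity
  elsewhere. Within \<open>good\<close>, points with equal images have equal twists and equal tails,
  hence are equal.\<close>

lemma bij_betw_mutation: "bij_betw mutation X X"
  unfolding bij_betw_def
proof
  show "inj_on mutation X"
  proof (rule inj_onI)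
    fix x y assume xy: "x \<in> X" "y \<in> X" "mutation x = mutation y"
    show "x = y"
    proof (cases "x \<in> good")
      case True
      then have "mutation y \<in> good" using mutation_good xy(3) by metis
      then have y: "y \<in> good" using mutation_not_good xy(2) by metis
      have "translate q 1 (twist q x) = translate q 1 (twist q y)"
        using twist_mutation[OF True] twist_mutation[OF y] xy(3) by simp
      then have "twist q x = twist q y"
        using xy twist_in_space by (metis translate_inverse(2))
      moreover have "same_tail x y"
        using same_tail_mutation[OF True] same_tail_mutation[OF y] xy(3)
        by (metis same_tail_sym same_tail_trans)
      ultimately show ?thesis using twist_inj_on_tails xy by blast
    next
      case False
      then have "mutation y \<notin> good" using mutation_not_good xy by metis
      then have "y \<notin> good" using mutation_good by blast
      then show ?thesis using False mutation_not_good xy by metis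
    qed
  qed
  show "mutation ` X = X"
  proof
    show "X \<subseteq> mutation ` X"
    proof
      fix x assume x: "x \<in> X"
      show "x \<in> mutation ` X"
      proof (cases "x \<in> good")
        case True
        then show ?thesis using mutation_preimage good_in_space by (metis image_eqI)
      next
        case False
        then show ?thesis using mutation_not_good[OF x] x by (metis image_eqI)
      qed
    qed
  qed (auto simp: mutation_in_space)
qed

lemma transf_inv_mutation:
  assumes "x \<in> good"
  shows "transf_inv M mutation x \<in> good"
    "twist q (transf_inv M mutation x) = translate q (- 1) (twist q x)"
proof -
  obtain z where z: "z \<in> good" "mutation z = x" "twist q z = translate q (- 1) (twist q x)"
    using mutation_preimage[OF assms] .
  then have "transf_inv M mutation x = z"
    using transf_inv_left[OF bij_betw_mutation good_in_space] by blast
  then show "transf_inv M mutation x \<in> good"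
    "twist q (transf_inv M mutation x) = translate q (- 1) (twist q x)"
    using z by simp_all
qed

lemma same_tail_transf_inv_mutation:
  assumes "x \<in> good"
  shows "same_tail (transf_inv M mutation x) x"
  using same_tail_mutation[OF transf_inv_mutation(1)[OF assms]] assms
    transf_inv_right[OF bij_betw_mutation good_in_space[OF assms]]
  by (simp add: same_tail_sym)

lemma transf_pow_mutation:
  assumes "x \<in> good"
  shows "transf_pow M mutation k x \<in> good \<and> same_tail (transf_pow M mutation k x) x \<and>
    twist q (transf_pow M mutation k x) = translate q k (twist q x)"
proof -
  note X = good_in_space[OF assms] twist_in_space[OF good_in_space[OF assms]]
  show ?thesis
  proof (induction k rule: int_induct[where k = 0])
    case (step1 k)
    then show ?case
      using same_tail_mutation[of "transf_pow M mutation k x"]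
      by (auto simp: transf_pow_step[OF bij_betw_mutation X(1)] mutation_good twist_mutation
          translate_translate X add.commute[of 1 k] intro: same_tail_trans)
  next
    case (step2 k)
    then show ?case
      using same_tail_transf_inv_mutation[of "transf_pow M mutation k x"]
      by (auto simp: transf_pow_step_back[OF bij_betw_mutation X(1)] transf_inv_mutation
          translate_translate X intro: same_tail_trans)
  qed (simp add: assms X)
qed

lemma odometer_cocycle_eq_iff:
  assumes "x \<in> good"
  shows "odometer_cocycle x = k \<longleftrightarrow> translate q k (twist q x) = twist q (translate q 1 x)"
proof -
  note X = good_in_space[OF assms] twist_in_space[OF good_in_space[OF assms]]
  have "same_tail (twist q x) (twist q (translate q 1 x))"
    by (rule same_tail_twist[OF same_tail_sym[OF same_tail_translate_good[OF assms]]])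
  then obtain m where "\<forall>k\<ge>m. twist q x k = twist q (translate q 1 x) k"
    unfolding same_tail_def by blast
  with eq_translate_if_same_tail[OF X(2) twist_in_space[OF translate_in_space], of m 1 x]
  obtain j where j: "translate q j (twist q x) = twist q (translate q 1 x)"
    by metis
  then have "translate q (odometer_cocycle x) (twist q x) = twist q (translate q 1 x)"
    unfolding odometer_cocycle_def using assms by (simp only: if_True) (rule someI)
  then show ?thesis using translate_inj[OF X(2)] by metis
qed

text \<open>Both sides lie in the tail class of \<open>x\<close> and have the same twist.\<close>

lemma odometer_eq_mutation_power:
  assumes "x \<in> good"
  shows "odometer q x = transf_pow M mutation (odometer_cocycle x) x"
proof -
  note P = transf_pow_mutation[OF assms, of "odometer_cocycle x"]
  have "twist q (transf_pow M mutation (odometer_cocycle x) x) = twist q (translate q 1 x)"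
    using P odometer_cocycle_eq_iff[OF assms] by metis
  moreover have "same_tail (transf_pow M mutation (odometer_cocycle x) x) (translate q 1 x)"
    using P same_tail_translate_good[OF assms] by (meson same_tail_sym same_tail_trans)
  ultimately show ?thesis
    using P good_in_space translate_in_space odometer_eq_translate[OF good_in_space[OF assms]]
    by (metis twist_inj_on_tails)
qed

lemma orbit_of_mutation:
  assumes "x \<in> good"
  shows "orbit_of M mutation x = orbit_of M (odometer q) x"
proof
  have sub: "good \<subseteq> X" by (auto simp: good_in_space)
  have "mutation x \<in> orbit_of M (odometer q) x" if "x \<in> good" for x
    using orbit_of_odometer[OF good_in_space[OF that]] by (simp add: mutation_def)
  then have "transf_pow M mutation k x \<in> orbit_of M (odometer q) x" for k
    using orbit_of_subset[OF bij_betw_mutation bij_betw_odometer sub, of x k] assms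
    by (simp add: mutation_good transf_inv_mutation)
  then show "orbit_of M mutation x \<subseteq> orbit_of M (odometer q) x"
    by (auto simp: orbit_of_def)
  have "odometer q x \<in> orbit_of M mutation x" if "x \<in> good" for x
    using odometer_eq_mutation_power[OF that] by (simp add: orbit_of_def)
  then have "transf_pow M (odometer q) k x \<in> orbit_of M mutation x" for k
    using orbit_of_subset[OF bij_betw_odometer bij_betw_mutation sub, of x k] assms
    by (simp add: good_in_space odometer_eq_translate transf_inv_odometer translate_good)
  then show "orbit_of M (odometer q) x \<subseteq> orbit_of M mutation x"
    by (auto simp: orbit_of_def)
qed

text \<open>Twisting a periodic point would give a fixed point of a nonzero translation.\<close>

lemma aperiodic_mutation: "aperiodic M mutation"
  unfolding aperiodic_def
  using AE_good
proof eventually_elim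
  fix x assume x: "x \<in> good"
  show "\<forall>n>0. (mutation ^^ n) x \<noteq> x"
  proof (intro allI impI notI)
    fix n :: nat assume "0 < n" "(mutation ^^ n) x = x"
    then have "translate q (int n) (twist q x) = twist q x"
      using transf_pow_mutation[OF x, of "int n"] by (simp add: transf_pow_of_nat)
    then show False
      using translate_fixed_point[OF twist_in_space[OF good_in_space[OF x]]] \<open>0 < n\<close> by fastforce
  qed
qed

lemma sets_Collect_eq:
  assumes f: "f \<in> measurable M M" and g: "g \<in> measurable M M"
  shows "{x \<in> X. f x = g x} \<in> sets M"
proof -
  have [measurable]: "(\<lambda>x. f x n) \<in> measurable M (count_space UNIV)"
    "(\<lambda>x. g x n) \<in> measurable M (count_space UNIV)" for n
    using measurable_compose[OF f measurable_digit] measurable_compose[OF g measurable_digit] by auto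
  have "{x \<in> X. f x = g x} = {x \<in> X. \<forall>n. \<exists>v. f x n = v \<and> g x n = v}"
    by (auto simp: fun_eq_iff)
  also have "\<dots> \<in> sets M" by measurable
  finally show ?thesis .
qed

lemma sets_good [measurable]: "good \<in> sets M"
proof -
  have z [measurable]: "zero_orbit \<in> sets M"
    using null_singleton zero_orbit_in_space
    by (intro sets.countable[of zero_orbit]) (auto simp: null_sets_def)
  have "good = {x \<in> X. x \<notin> zero_orbit \<and> twist q x \<notin> zero_orbit}"
    by (rule good_def)
  also have "\<dots> \<in> sets M" by measurable
  finally show ?thesis .
qed

text \<open>The cocycles are defined by choice; measurability comes from the equations between
  measurable maps that characterize each of their values on \<open>good\<close>.\<close>

lemma measurable_int_cocycle:
  fixes c :: "(nat \<Rightarrow> nat) \<Rightarrow> int"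
  assumes eq: "\<And>x k. x \<in> good \<Longrightarrow> c x = k \<longleftrightarrow> f k x = g k x"
    and not_good: "\<And>x. x \<notin> good \<Longrightarrow> c x = 0"
    and f: "\<And>k. f k \<in> measurable M M" and g: "\<And>k. g k \<in> measurable M M"
  shows "c \<in> measurable M (count_space UNIV)"
proof -
  have "c -` {k} \<inter> X \<in> sets M" for k
  proof -
    have "c -` {k} \<inter> X = (if k = 0 then X - good else {}) \<union> (good \<inter> {x \<in> X. f k x = g k x})"
      using eq not_good by (auto simp: good_in_space)
    also have "\<dots> \<in> sets M"
      using sets_Collect_eq[OF f g] by auto
    finally show ?thesis .
  qed
  then show ?thesis by (simp add: measurable_count_space_eq_countable)
qed

lemma measurable_mutation_cocycle [measurable]:
  "mutation_cocycle \<in> measurable M (count_space UNIV)"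
  by (rule measurable_int_cocycle[where f = "\<lambda>k x. twist q (translate q k x)"
        and g = "\<lambda>_ x. translate q 1 (twist q x)"])
     (auto simp: mutation_cocycle_eq_iff, simp add: mutation_cocycle_def)

lemma measurable_odometer_cocycle [measurable]:
  "odometer_cocycle \<in> measurable M (count_space UNIV)"
  by (rule measurable_int_cocycle[where f = "\<lambda>k x. translate q k (twist q x)"
        and g = "\<lambda>_ x. twist q (translate q 1 x)"])
     (auto simp: odometer_cocycle_eq_iff, simp add: odometer_cocycle_def)

lemma pmp_transformation_mutation: "pmp_transformation M mutation"
  unfolding pmp_transformation_def
  using standard_atomless_odometer_space bij_betw_mutation
  by (auto intro!: mp_bijection_piecewise_translate[OF measurable_mutation_cocycle] simp: mutation_def)

section \<open>Bounds on the cocycles and finiteness of their integrals\<close>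

lemma trunc_Suc_diff_bound:
  assumes "x \<in> X" "y \<in> X" "\<bar>int (y n) - int (x n)\<bar> \<le> 3"
  shows "\<bar>int (trunc q (Suc n) y) - int (trunc q (Suc n) x)\<bar> \<le> 4 * int (place q n)"
proof -
  \<comment> \<open>The digits below \<open>n\<close> account for one multiple of
    \<open>place q n\<close>, and the digit \<open>n\<close> for at most three.\<close>
  have "\<bar>int (trunc q n y) - int (trunc q n x)\<bar> \<le> int (place q n)"
    using trunc_less[OF assms(1), of n] trunc_less[OF assms(2), of n] by linarith
  moreover have "\<bar>(int (y n) - int (x n)) * int (place q n)\<bar> \<le> 3 * int (place q n)"
    using assms(3) by (simp add: abs_mult mult_right_mono)
  moreover have "int (trunc q (Suc n) y) - int (trunc q (Suc n) x) =
      (int (trunc q n y) - int (trunc q n x)) + (int (y n) - int (x n)) * int (place q n)"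
    by (simp add: trunc_Suc algebra_simps)
  ultimately show ?thesis by linarith
qed

text \<open>When the carry stops at \<open>n\<close>, the point and its successor agree above
  \<open>n\<close>, hence so do their twists. Their digits at \<open>n\<close> are consecutive and
  are subject to the same conditional swap.\<close>

lemma odometer_cocycle_bound:
  assumes x: "x \<in> good" and n: "\<And>k. k < n \<Longrightarrow> x k = q k - 1" "Suc (x n) < q n"
  shows "\<bar>odometer_cocycle x\<bar> \<le> 4 * int (place q n)"
proof -
  have X: "x \<in> X" using x by (rule good_in_space)
  let ?y = "translate q 1 x"
  have y: "?y = (\<lambda>k. if k < n then 0 else if k = n then Suc (x n) else x k)"
    by (rule translate_1_carry[OF X n])
  have t: "twist q x \<in> X" "twist q ?y \<in> X"
    using X translate_in_space by (auto intro: twist_in_space)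
  have "twist q x k = twist q ?y k" if "Suc n \<le> k" for k
    using that by (simp add: twist_def y)
  then have "odometer_cocycle x = int (trunc q (Suc n) (twist q ?y)) - int (trunc q (Suc n) (twist q x))"
    unfolding odometer_cocycle_eq_iff[OF x]
    using eq_translate_if_same_tail[OF t, of "Suc n"] by simp
  moreover have "\<bar>int (twist q ?y n) - int (twist q x n)\<bar> \<le> 3"
    using cond_swap_Suc_close by (simp add: twist_def y)
  ultimately show ?thesis using trunc_Suc_diff_bound[OF t] by simp
qed

text \<open>Here the carry takes place after twisting. Agreement of the twists above
  \<open>n\<close> is lifted back to the points themselves, as they share a tail; undoing the same
  swap on consecutive digits costs at most 3.\<close>

lemma mutation_cocycle_bound:
  assumes x: "x \<in> good" and n: "\<And>k. k < n \<Longrightarrow> twist q x k = q k - 1" "Suc (twist q x n) < q n"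
  shows "\<bar>mutation_cocycle x\<bar> \<le> 4 * int (place q n)"
proof -
  have X: "x \<in> X" "mutation x \<in> X" using x by (auto intro: good_in_space mutation_in_space)
  define y where "y = twist q x"
  have yX: "y \<in> X" using X by (simp add: y_def twist_in_space)
  have Ty: "twist q (mutation x) = (\<lambda>k. if k < n then 0 else if k = n then Suc (y n) else y k)"
    using translate_1_carry[OF yX, of n] n by (simp add: twist_mutation[OF x] y_def)
  have above: "x k = mutation x k" if "Suc n \<le> k" for k
  proof (rule twist_eq_imp_eq_above[OF X _ _ that])
    show "same_tail x (mutation x)" using same_tail_mutation[OF x] by (rule same_tail_sym)
    show "twist q x k = twist q (mutation x) k" if "Suc n \<le> k" for k
      using that by (simp add: Ty y_def)
  qed
  \<comment> \<open>The conditional swap is an involution, so it also recovers a digit from its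
    twist.\<close>
  have digit: "z n = cond_swap (q n) (z (Suc n)) (twist q z n)" if "z \<in> X" for z
    using digit_less[OF that, of n] by (simp add: twist_def)
  have "mutation x = translate q (int (trunc q (Suc n) (mutation x)) - int (trunc q (Suc n) x)) x"
    using eq_translate_if_same_tail[OF X above] .
  then have "mutation_cocycle x = int (trunc q (Suc n) (mutation x)) - int (trunc q (Suc n) x)"
    using translate_inj[OF X(1)] by (metis mutation_def)
  moreover have "\<bar>int (mutation x n) - int (x n)\<bar> \<le> 3"
    using cond_swap_Suc_close[of "q n" "x (Suc n)" "y n"] digit[OF X(1)] digit[OF X(2)] above[of "Suc n"]
    by (simp add: Ty y_def)
  ultimately show ?thesis using trunc_Suc_diff_bound[OF X] by simp
qed

text \<open>The map \<rho> shows where the carry runs: it is the identity for the odometer and the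
  twist for \<open>mutation\<close>. As it preserves measure, the carry reaches the digit
  \<open>n\<close> with probability \<open>1 / place q n\<close>, and the integrand is dominated by
  the sum of the \<open>b n\<close> over these events.\<close>

lemma nn_integral_cocycle_finite:
  fixes c :: "(nat \<Rightarrow> nat) \<Rightarrow> int" and b :: "nat \<Rightarrow> real"
  assumes \<rho>: "\<rho> \<in> measurable M M" "distr M M \<rho> = M"
    and c: "AE x in M. \<exists>n. (\<forall>k<n. \<rho> x k = q k - 1) \<and> \<bar>c x\<bar> \<le> 4 * int (place q n)"
    and b: "\<And>n k. k \<le> 4 * place q n \<Longrightarrow> \<phi> (real k) \<le> b n" "\<And>n. 0 \<le> b n"
      "summable (\<lambda>n. b n / real (place q n))"
  shows "(\<integral>\<^sup>+ x. ennreal (\<phi> (real_of_int \<bar>c x\<bar>)) \<partial>M) < \<infinity>"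
proof -
  define Z where "Z n = {x \<in> X. \<forall>k<n. \<rho> x k = q k - 1}" for n
  note [measurable] = \<rho>(1)
  have [measurable]: "(\<lambda>x. \<rho> x n) \<in> measurable M (count_space UNIV)" for n
    by (rule measurable_compose[OF \<rho>(1) measurable_digit])
  have [measurable]: "Z n \<in> sets M" for n
    unfolding Z_def by measurable
  have Z: "emeasure M (Z n) = ennreal (1 / real (place q n))" for n
  proof -
    have m: "(\<lambda>k. q k - 1) \<in> X" by (simp add: space_odometer)
    have "emeasure M {x \<in> X. \<forall>k<n. x k = q k - 1} = emeasure (distr M M \<rho>) {x \<in> X. \<forall>k<n. x k = q k - 1}"
      by (simp only: \<rho>(2))
    also have "\<dots> = emeasure M (Z n)"
      using measurable_space[OF \<rho>(1)]
      by (subst emeasure_distr) (auto simp: Z_def intro!: arg_cong2[where f = emeasure])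
    finally show ?thesis using emeasure_digits[OF m, of n] by simp
  qed
  have term_le: "g n \<le> suminf g" for g :: "nat \<Rightarrow> ennreal" and n
    using sum_le_suminf[OF summableI, of "{n}" g] by simp
  have "(\<integral>\<^sup>+ x. ennreal (\<phi> (real_of_int \<bar>c x\<bar>)) \<partial>M) \<le>
      (\<integral>\<^sup>+ x. (\<Sum>n. ennreal (b n) * indicator (Z n) x) \<partial>M)"
  proof (rule nn_integral_mono_AE)
    show "AE x in M. ennreal (\<phi> (real_of_int \<bar>c x\<bar>)) \<le> (\<Sum>n. ennreal (b n) * indicator (Z n) x)"
      using c AE_space
    proof eventually_elim
      fix x assume "\<exists>n. (\<forall>k<n. \<rho> x k = q k - 1) \<and> \<bar>c x\<bar> \<le> 4 * int (place q n)" and x: "x \<in> X"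
      then obtain n where n: "\<forall>k<n. \<rho> x k = q k - 1" "\<bar>c x\<bar> \<le> 4 * int (place q n)" by blast
      have "\<phi> (real (nat \<bar>c x\<bar>)) \<le> b n"
        using n(2) by (intro b(1)) linarith
      then have "ennreal (\<phi> (real_of_int \<bar>c x\<bar>)) \<le> ennreal (b n) * indicator (Z n) x"
        using n(1) x by (simp add: Z_def ennreal_leI)
      also have "\<dots> \<le> (\<Sum>n. ennreal (b n) * indicator (Z n) x)"
        by (rule term_le)
      finally show "ennreal (\<phi> (real_of_int \<bar>c x\<bar>)) \<le> (\<Sum>n. ennreal (b n) * indicator (Z n) x)" .
    qed
  qed
  also have "\<dots> = (\<Sum>n. ennreal (b n) * emeasure M (Z n))"
    by (subst nn_integral_suminf) (auto simp: nn_integral_cmult_indicator)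
  also have "\<dots> = (\<Sum>n. ennreal (b n / real (place q n)))"
    using b(2) by (simp add: Z ennreal_mult[symmetric])
  also have "\<dots> = ennreal (\<Sum>n. b n / real (place q n))"
    using b(2,3) by (intro suminf_ennreal2) auto
  also have "\<dots> < \<infinity>" by simp
  finally show ?thesis .
qed

lemma nn_integral_cocycles_finite:
  fixes b :: "nat \<Rightarrow> real"
  assumes b: "\<And>n k. k \<le> 4 * place q n \<Longrightarrow> \<phi> (real k) \<le> b n" "\<And>n. 0 \<le> b n"
      "summable (\<lambda>n. b n / real (place q n))"
  shows "(\<integral>\<^sup>+ x. ennreal (\<phi> (real_of_int \<bar>odometer_cocycle x\<bar>)) \<partial>M) < \<infinity>"
    "(\<integral>\<^sup>+ x. ennreal (\<phi> (real_of_int \<bar>mutation_cocycle x\<bar>)) \<partial>M) < \<infinity>"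
proof -
  show "(\<integral>\<^sup>+ x. ennreal (\<phi> (real_of_int \<bar>odometer_cocycle x\<bar>)) \<partial>M) < \<infinity>"
  proof (rule nn_integral_cocycle_finite[where \<rho> = "\<lambda>x. x" and \<phi> = \<phi> and b = b, OF _ _ _ b])
    show "AE x in M. \<exists>n. (\<forall>k<n. x k = q k - 1) \<and> \<bar>odometer_cocycle x\<bar> \<le> 4 * int (place q n)"
      using AE_good
    proof eventually_elim
      fix x assume x: "x \<in> good"
      then obtain n where "\<And>k. k < n \<Longrightarrow> x k = q k - 1" "Suc (x n) < q n"
        using carry_stops[of x] by (auto simp: good_def)
      then show "\<exists>n. (\<forall>k<n. x k = q k - 1) \<and> \<bar>odometer_cocycle x\<bar> \<le> 4 * int (place q n)"
        using odometer_cocycle_bound[OF x] by blast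
    qed
  qed (simp_all add: distr_id2)
  show "(\<integral>\<^sup>+ x. ennreal (\<phi> (real_of_int \<bar>mutation_cocycle x\<bar>)) \<partial>M) < \<infinity>"
  proof (rule nn_integral_cocycle_finite[where \<rho> = "twist q" and \<phi> = \<phi> and b = b, OF measurable_twist distr_twist _ b])
    show "AE x in M. \<exists>n. (\<forall>k<n. twist q x k = q k - 1) \<and> \<bar>mutation_cocycle x\<bar> \<le> 4 * int (place q n)"
      using AE_good
    proof eventually_elim
      fix x assume x: "x \<in> good"
      then obtain n where "\<And>k. k < n \<Longrightarrow> twist q x k = q k - 1" "Suc (twist q x n) < q n"
        using carry_stops[OF twist_in_space, of x] by (auto simp: good_def)
      then show "\<exists>n. (\<forall>k<n. twist q x k = q k - 1) \<and> \<bar>mutation_cocycle x\<bar> \<le> 4 * int (place q n)"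
        using mutation_cocycle_bound[OF x] by blast
    qed
  qed auto
qed

section \<open>Failure of injectivity of the twist\<close>

definition flip_digits :: "(nat \<Rightarrow> nat) \<Rightarrow> nat \<Rightarrow> nat" where
  "flip_digits x = (\<lambda>n. swap_pair (q n) (x n))"

lemma flip_digits_in_space: "x \<in> X \<Longrightarrow> flip_digits x \<in> X"
  by (simp add: space_odometer flip_digits_def swap_pair_less)

lemma measurable_flip_digits [measurable]: "flip_digits \<in> measurable M M"
proof (rule measurable_into_odometer_space)
  fix n
  show "(\<lambda>x. flip_digits x n) \<in> measurable M (count_space UNIV)"
    unfolding flip_digits_def by (rule measurable_compose[OF measurable_digit]) simp
qed (rule flip_digits_in_space)

lemma distr_flip_digits: "distr M M flip_digits = M"
proof (rule distr_eq_odometer_space)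
  fix n v assume v: "v < place q n"
  obtain a where a: "a \<in> X" "trunc q n a = v" using exists_trunc[OF v] .
  have "flip_digits x k = a k \<longleftrightarrow> x k = flip_digits a k" if "x \<in> X" for x k
    using digit_less[OF that, of k] digit_less[OF a(1), of k]
    unfolding flip_digits_def by (metis swap_pair_involution)
  then have "{x \<in> X. trunc q n (flip_digits x) = v} = {x \<in> X. \<forall>k<n. x k = flip_digits a k}"
    using trunc_eq_iff[OF flip_digits_in_space a(1), of _ n] a(2) by auto
  then show "emeasure M {x \<in> X. trunc q n (flip_digits x) = v} = ennreal (1 / real (place q n))"
    using emeasure_digits[OF flip_digits_in_space[OF a(1)], of n] by simp
qed measurable

text \<open>The hypothesis gives every digit a partner, so flipping reverses all parities. At each
  position either the twist swaps \<open>x\<close> and leaves the flipped point alone, or it swaps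
  the flipped point back; the results coincide.\<close>

lemma twist_flip_digits:
  assumes "x \<in> X" "\<And>n. Suc (x n) < q n"
  shows "twist q (flip_digits x) = twist q x" "flip_digits x \<noteq> x"
proof -
  have parity: "odd (flip_digits x n) \<longleftrightarrow> even (x n)" for n
    using assms(2)[of n] by (auto simp: flip_digits_def swap_pair_def)
  show "twist q (flip_digits x) = twist q x"
  proof
    fix n
    show "twist q (flip_digits x) n = twist q x n"
      using parity[of "Suc n"] digit_less[OF assms(1), of n]
      by (auto simp: twist_def cond_swap_def) (simp_all add: flip_digits_def)
  qed
  show "flip_digits x \<noteq> x" using parity by metis
qed

lemma emeasure_digit:
  assumes "v < q n"
  shows "emeasure M {x \<in> X. x n = v} = ennreal (1 / real (q n))"
proof -
  have d: "distr M (uniform_count_measure {..<q n}) (\<lambda>x. x n) = uniform_count_measure {..<q n}"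
    unfolding odometer_space_def
    by (intro distr_PiM_component prob_space_uniform_count_measure) (auto simp: lessThan_empty_iff)
  have m: "(\<lambda>x. x n) \<in> measurable M (uniform_count_measure {..<q n})"
    unfolding odometer_space_def by (rule measurable_component_singleton) simp
  have "emeasure (uniform_count_measure {..<q n}) {v} =
      emeasure (distr M (uniform_count_measure {..<q n}) (\<lambda>x. x n)) {v}"
    by (simp only: d)
  also have "\<dots> = emeasure M {x \<in> X. x n = v}"
    using assms by (subst emeasure_distr[OF m])
      (auto simp: sets_uniform_count_measure intro!: arg_cong2[where f = emeasure])
  finally show ?thesis using assms by (simp add: emeasure_uniform_count_measure)
qed

text \<open>The events that some digit is maximal have total probability at most 1/2, so a non-null
  set of points has none. Flipping preserves the measure, so almost every such point satisfies
  \<open>P\<close> together with its flip.\<close>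

lemma twist_not_injective:
  assumes q: "\<And>n. 2 ^ (n + 2) \<le> q n" and P: "AE x in M. P x"
  shows "\<exists>x\<in>X. \<exists>y\<in>X. P x \<and> P y \<and> x \<noteq> y \<and> twist q x = twist q y"
proof (rule ccontr)
  assume no: "\<not> ?thesis"
  define Z where "Z n = {x \<in> X. x n = q n - 1}" for n
  have [measurable]: "Z n \<in> sets M" for n
    unfolding Z_def by measurable
  have Z: "emeasure M (Z n) \<le> ennreal ((1/2) ^ (n + 2))" for n
  proof -
    have "real (2 ^ (n + 2)) \<le> real (q n)"
      using q[of n] by (rule of_nat_mono)
    then have "1 / real (q n) \<le> 1 / 2 ^ (n + 2)"
      by (intro divide_left_mono) auto
    then show ?thesis
      unfolding Z_def by (subst emeasure_digit) (auto simp: power_one_over intro: ennreal_leI)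
  qed
  have "AE x in M. P (flip_digits x)"
    by (rule AE_distrD[OF measurable_flip_digits]) (simp only: distr_flip_digits P)
  then have "AE x in M. x \<in> (\<Union>n. Z n)"
    using P AE_space
  proof eventually_elim
    fix x assume x: "P (flip_digits x)" "P x" "x \<in> X"
    then have "\<exists>n. \<not> Suc (x n) < q n"
      using no twist_flip_digits[of x] flip_digits_in_space[of x] by metis
    then obtain n where "\<not> Suc (x n) < q n" by blast
    then have "x n = q n - 1" using digit_less[OF x(3), of n] by linarith
    then show "x \<in> (\<Union>n. Z n)" using x(3) by (auto simp: Z_def)
  qed
  then have "emeasure M (\<Union>n. Z n) = 1"
    by (intro emeasure_eq_1_AE) measurable
  moreover have "emeasure M (\<Union>n. Z n) \<le> (\<Sum>n. emeasure M (Z n))"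
    by (rule emeasure_subadditive_countably) auto
  moreover have "\<dots> \<le> (\<Sum>n. ennreal ((1/2) ^ (n + 2)))"
    by (intro suminf_le Z summableI)
  moreover have "(\<Sum>n. ennreal ((1/2) ^ (n + 2))) = ennreal (1/2)"
  proof -
    have "(\<lambda>n. (1/2 :: real) ^ n * (1/4)) sums (2 * (1/4))"
      using geometric_sums[of "1/2 :: real"] by (intro sums_mult2) simp
    then have s: "(\<lambda>n. (1/2 :: real) ^ (n + 2)) sums (1/2)"
      by (simp add: power_add power2_eq_square)
    have "(\<Sum>n. ennreal ((1/2) ^ (n + 2))) = ennreal (\<Sum>n. (1/2) ^ (n + 2))"
      by (rule suminf_ennreal2[OF _ sums_summable[OF s]]) simp
    then show ?thesis by (simp only: sums_unique[OF s, symmetric])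
  qed
  ultimately have "ennreal 1 \<le> ennreal (1/2)" by (metis order_trans ennreal_1)
  then show False by (subst (asm) ennreal_le_iff) auto
qed

end

section \<open>Transport of powers and of measures along bijections\<close>

lemma transf_pow_conjugate:
  assumes R: "bij_betw R (space M) (space N)" and T: "bij_betw T (space N) (space N)"
    and x: "x \<in> space M"
  defines "F \<equiv> inv_into (space M) R \<circ> T \<circ> R"
  shows "transf_pow M F k x = inv_into (space M) R (transf_pow N T k (R x))"
proof -
  let ?I = "inv_into (space M) R"
  have I: "bij_betw ?I (space N) (space M)" using R by (rule bij_betw_inv_into)
  have F: "bij_betw F (space M) (space M)"
    unfolding F_def using bij_betw_trans[OF bij_betw_trans[OF R T] I] by (simp add: comp_assoc)
  have Rx: "R x \<in> space N" using R x by (metis bij_betwE)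
  have FI: "F (?I y) = ?I (T y)" if "y \<in> space N" for y
    using bij_betw_inv_into_right[OF R that] by (simp add: F_def)
  have inv: "transf_inv M F (?I y) = ?I (transf_inv N T y)" if y: "y \<in> space N" for y
  proof -
    have "F (?I (transf_inv N T y)) = ?I y"
      using FI[OF transf_inv_in_space[OF T y]] transf_inv_right[OF T y] by simp
    then show ?thesis
      using transf_inv_left[OF F, of "?I (transf_inv N T y)"] I transf_inv_in_space[OF T y]
      by (metis bij_betwE)
  qed
  show ?thesis
  proof (induction k rule: int_induct[where k = 0])
    case base
    then show ?case using bij_betw_inv_into_left[OF R x] by simp
  next
    case (step1 k)
    then show ?case
      by (simp only: transf_pow_step[OF F x] transf_pow_step[OF T Rx] FI transf_pow_in_space[OF T Rx])
  next
    case (step2 k)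
    then show ?case
      by (simp only: transf_pow_step_back[OF F x] transf_pow_step_back[OF T Rx] inv
          transf_pow_in_space[OF T Rx])
  qed
qed

lemma mp_bijection_distr_inv_into:
  assumes "mp_bijection M N f"
  shows "distr N M (inv_into (space M) f) = M"
proof -
  let ?g = "inv_into (space M) f"
  have f: "bij_betw f (space M) (space N)" "f \<in> measurable M N" "?g \<in> measurable N M"
    "distr M N f = N"
    using assms by (auto simp: mp_bijection_def)
  have "distr N M ?g = distr (distr M N f) M ?g" by (simp only: f)
  also have "\<dots> = distr M M (?g \<circ> f)"
    using f by (intro distr_distr) auto
  also have "\<dots> = distr M M (\<lambda>x. x)"
    using bij_betw_inv_into_left[OF f(1)] by (intro distr_cong) auto
  finally show ?thesis by (simp add: distr_id2)
qed

section \<open>Grouping digits into blocks\<close>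

text \<open>The product of the radices in the block from \<open>m i\<close> to
  \<open>m (Suc i)\<close>, written as a quotient that is exact when \<open>m\<close>
  increases.\<close>

definition regroup_radix :: "(nat \<Rightarrow> nat) \<Rightarrow> (nat \<Rightarrow> nat) \<Rightarrow> nat \<Rightarrow> nat" where
  "regroup_radix q m i = place q (m (Suc i)) div place q (m i)"

definition regroup :: "(nat \<Rightarrow> nat) \<Rightarrow> (nat \<Rightarrow> nat) \<Rightarrow> (nat \<Rightarrow> nat) \<Rightarrow> nat \<Rightarrow> nat" where
  "regroup q m x = (\<lambda>i. trunc q (m (Suc i)) x div place q (m i))"

text \<open>Since \<open>n \<le> m n\<close>, the first \<open>Suc n\<close> block digits already
  determine the first \<open>Suc n\<close> original digits, by reduction modulo
  \<open>place q (Suc n)\<close>.\<close>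

definition ungroup :: "(nat \<Rightarrow> nat) \<Rightarrow> (nat \<Rightarrow> nat) \<Rightarrow> (nat \<Rightarrow> nat) \<Rightarrow> nat \<Rightarrow> nat" where
  "ungroup q m y =
     (\<lambda>n. trunc (regroup_radix q m) (Suc n) y mod place q (Suc n) div place q n)"

lemma (in mixed_radix) place_add_ge: "2 ^ j * place q n \<le> place q (n + j)"
proof (induction j)
  case (Suc j)
  have "2 * (2 ^ j * place q n) \<le> q (n + j) * place q (n + j)"
    using Suc q_ge2 by (intro mult_mono) auto
  then show ?case by (simp add: place_Suc ac_simps)
qed simp

locale regrouping = mixed_radix +
  fixes m :: "nat \<Rightarrow> nat"
  assumes m_strict_mono: "strict_mono m" and m_0: "m 0 = 0"
begin

abbreviation "Q \<equiv> regroup_radix q m"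

lemma le_m: "i \<le> m i"
  using m_strict_mono by (rule strict_mono_imp_increasing)

lemma place_mult_Q: "place q (m i) * Q i = place q (m (Suc i))"
  unfolding regroup_radix_def
  using m_strict_mono by (intro dvd_mult_div_cancel place_dvd) (simp add: strict_mono_less_eq)

lemma place_Q: "place Q i = place q (m i)"
  by (induction i) (simp_all add: m_0 place_Suc place_mult_Q)

lemma Q_ge2: "2 \<le> Q i"
proof -
  have "place q (m i) * 2 \<le> place q (m i) * q (m i)" using q_ge2 by simp
  also have "\<dots> = place q (Suc (m i))" by (simp add: place_Suc)
  also have "\<dots> \<le> place q (m (Suc i))"
  proof (rule dvd_imp_le[OF place_dvd])
    show "Suc (m i) \<le> m (Suc i)"
      using m_strict_mono by (simp add: strict_mono_Suc_iff Suc_le_eq)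
  qed simp
  finally have "place q (m i) * 2 \<le> place q (m i) * Q i" by (simp only: place_mult_Q)
  then show ?thesis by simp
qed

sublocale Q: mixed_radix Q
  by standard (rule Q_ge2)

lemma regroup_in_space: "x \<in> X \<Longrightarrow> regroup q m x \<in> Q.X"
  and trunc_regroup: "x \<in> X \<Longrightarrow> trunc Q i (regroup q m x) = trunc q (m i) x"
proof -
  assume x: "x \<in> X"
  have lt: "trunc q (m i) x < place Q i" for i
    using trunc_less[OF x] by (simp add: place_Q)
  have coh: "trunc q (m (Suc i)) x mod place Q i = trunc q (m i) x" for i
    using m_strict_mono unfolding place_Q
    by (intro trunc_mod[OF x]) (simp add: strict_mono_less_eq)
  have eq: "regroup q m x = (\<lambda>i. trunc q (m (Suc i)) x div place Q i)"
    by (simp add: regroup_def place_Q)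
  show "regroup q m x \<in> Q.X" "trunc Q i (regroup q m x) = trunc q (m i) x"
    unfolding eq by (rule Q.coherent_digits[OF lt coh])+
qed

lemma ungroup_in_space: "y \<in> Q.X \<Longrightarrow> ungroup q m y \<in> X"
  and trunc_ungroup: "y \<in> Q.X \<Longrightarrow> trunc q n (ungroup q m y) = trunc Q n y mod place q n"
proof -
  assume y: "y \<in> Q.X"
  have lt: "trunc Q n y mod place q n < place q n" for n by simp
  have coh: "trunc Q (Suc n) y mod place q (Suc n) mod place q n = trunc Q n y mod place q n" for n
  proof -
    have "trunc Q (Suc n) y mod place q (Suc n) mod place q n = trunc Q (Suc n) y mod place q n"
      by (rule mod_mod_cancel) (simp add: place_Suc)
    also have "\<dots> = trunc Q (Suc n) y mod place Q n mod place q n"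
      using place_dvd[OF le_m] by (simp add: mod_mod_cancel place_Q)
    finally show ?thesis by (simp add: Q.trunc_Suc_mod[OF y])
  qed
  show "ungroup q m y \<in> X" "trunc q n (ungroup q m y) = trunc Q n y mod place q n"
    unfolding ungroup_def by (rule coherent_digits[OF lt coh])+
qed

lemma regroup_ungroup: "y \<in> Q.X \<Longrightarrow> regroup q m (ungroup q m y) = y"
proof (rule Q.eqI_trunc[where m = 0])
  fix n assume y: "y \<in> Q.X"
  have "trunc Q n (regroup q m (ungroup q m y)) = trunc Q (m n) y mod place q (m n)"
    using y by (simp add: trunc_regroup ungroup_in_space trunc_ungroup)
  then show "trunc Q n (regroup q m (ungroup q m y)) = trunc Q n y"
    using Q.trunc_mod[OF y le_m, of n] by (simp add: place_Q)
qed (auto simp: regroup_in_space ungroup_in_space)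

lemma ungroup_regroup: "x \<in> X \<Longrightarrow> ungroup q m (regroup q m x) = x"
proof (rule eqI_trunc[where m = 0])
  fix n assume x: "x \<in> X"
  then show "trunc q n (ungroup q m (regroup q m x)) = trunc q n x"
    using trunc_mod[OF x le_m, of n] by (simp add: trunc_regroup regroup_in_space trunc_ungroup)
qed (auto simp: regroup_in_space ungroup_in_space)

lemma bij_betw_regroup: "bij_betw (regroup q m) X Q.X"
  by (rule bij_betw_byWitness[where f' = "ungroup q m"])
     (auto simp: regroup_in_space ungroup_in_space regroup_ungroup ungroup_regroup)

lemma inv_into_regroup: "y \<in> Q.X \<Longrightarrow> inv_into X (regroup q m) y = ungroup q m y"
  using bij_betw_inv_into_left[OF bij_betw_regroup ungroup_in_space] regroup_ungroup by metis

text \<open>Both sides have the same residue modulo \<open>place Q i = place q (m i)\<close>.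
  Regrouping thus conjugates the two odometers.\<close>

lemma regroup_translate: "x \<in> X \<Longrightarrow> regroup q m (translate q k x) = translate Q k (regroup q m x)"
  by (rule Q.eqI_int_trunc[where m = 0])
     (simp_all add: regroup_in_space translate_in_space Q.translate_in_space trunc_regroup
       trunc_translate Q.trunc_translate place_Q)

lemma ungroup_translate:
  assumes "y \<in> Q.X"
  shows "ungroup q m (translate Q k y) = translate q k (ungroup q m y)"
  using regroup_translate[OF ungroup_in_space[OF assms], of k] assms
  by (metis regroup_ungroup ungroup_regroup translate_in_space)

lemma measurable_regroup [measurable]: "regroup q m \<in> measurable M Q.M"
proof (rule Q.measurable_into_odometer_space)
  fix n
  show "(\<lambda>x. regroup q m x n) \<in> measurable M (count_space UNIV)"
    unfolding regroup_def by (rule measurable_compose[OF measurable_trunc]) simp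
qed (rule regroup_in_space)

lemma distr_regroup: "distr M Q.M (regroup q m) = Q.M"
proof (rule Q.distr_eq_odometer_space)
  fix n v assume "v < place Q n"
  then have "emeasure M {x \<in> X. trunc q (m n) x = v} = ennreal (1 / real (place q (m n)))"
    by (intro emeasure_level) (simp add: place_Q)
  then show "emeasure M {x \<in> X. trunc Q n (regroup q m x) = v} = ennreal (1 / real (place Q n))"
    by (simp add: place_Q trunc_regroup cong: conj_cong)
qed measurable

lemma mp_bijection_regroup: "mp_bijection M Q.M (regroup q m)"
proof -
  have "ungroup q m \<in> measurable Q.M M"
  proof (rule measurable_into_odometer_space)
    fix n
    show "(\<lambda>x. ungroup q m x n) \<in> measurable Q.M (count_space UNIV)"
      unfolding ungroup_def by (rule measurable_compose[OF Q.measurable_trunc]) simp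
  qed (rule ungroup_in_space)
  then have "inv_into X (regroup q m) \<in> measurable Q.M M"
    by (rule measurable_cong[THEN iffD2, rotated]) (rule inv_into_regroup)
  then show ?thesis
    using bij_betw_regroup distr_regroup by (simp add: mp_bijection_def)
qed

lemma AE_regroup: "AE y in Q.M. P y \<Longrightarrow> AE x in M. P (regroup q m x)"
  by (rule AE_distrD[OF measurable_regroup]) (simp only: distr_regroup)

text \<open>The orbit equivalence is the regrouping itself: on the block side
  \<open>mutation\<close> has almost everywhere the orbits of the block odometer, and these
  correspond to the original orbits.\<close>

lemma orbit_equivalence_regroup:
  "orbit_equivalence M (odometer q) Q.M Q.mutation (regroup q m)"
proof -
  let ?I = "inv_into X (regroup q m)"
  have "AE x in M. orbit_of M (odometer q) x = orbit_of M (?I \<circ> Q.mutation \<circ> regroup q m) x"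
    using AE_regroup[OF Q.AE_good] AE_space
  proof eventually_elim
    fix x assume good: "regroup q m x \<in> Q.good" and x: "x \<in> X"
    let ?y = "regroup q m x"
    have y: "?y \<in> Q.X" using x by (rule regroup_in_space)
    have "orbit_of M (?I \<circ> Q.mutation \<circ> regroup q m) x = ?I ` orbit_of Q.M Q.mutation ?y"
      unfolding orbit_of_def
      by (simp add: transf_pow_conjugate[OF bij_betw_regroup Q.bij_betw_mutation x] image_image)
    also have "\<dots> = ?I ` range (\<lambda>k. translate Q k ?y)"
      by (simp only: Q.orbit_of_mutation[OF good] Q.orbit_of_odometer[OF y])
    also have "\<dots> = range (\<lambda>k. translate q k x)"
      using y x by (simp add: image_image inv_into_regroup Q.translate_in_space ungroup_translate ungroup_regroup)
    finally show "orbit_of M (odometer q) x = orbit_of M (?I \<circ> Q.mutation \<circ> regroup q m) x"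
      by (simp add: orbit_of_odometer[OF x])
  qed
  then show ?thesis
    unfolding orbit_equivalence_def
    using pmp_transformation_odometer aperiodic_odometer Q.pmp_transformation_mutation
      Q.aperiodic_mutation mp_bijection_regroup by blast
qed

lemma source_cocycle_regroup:
  "source_cocycle M (odometer q) Q.M Q.mutation (regroup q m) (\<lambda>x. Q.odometer_cocycle (regroup q m x))"
  unfolding source_cocycle_def
proof
  show "AE x in M. odometer q x = inv_into X (regroup q m)
      (transf_pow Q.M Q.mutation (Q.odometer_cocycle (regroup q m x)) (regroup q m x))"
    using AE_regroup[OF Q.AE_good] AE_space
  proof eventually_elim
    fix x assume good: "regroup q m x \<in> Q.good" and x: "x \<in> X"
    have y: "regroup q m x \<in> Q.X" using x by (rule regroup_in_space)
    show "odometer q x = inv_into X (regroup q m)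
        (transf_pow Q.M Q.mutation (Q.odometer_cocycle (regroup q m x)) (regroup q m x))"
      using x y by (simp add: Q.odometer_eq_mutation_power[OF good, symmetric]
          Q.odometer_eq_translate odometer_eq_translate inv_into_regroup Q.translate_in_space
          ungroup_translate ungroup_regroup)
  qed
qed measurable

lemma target_cocycle_regroup:
  "target_cocycle M (odometer q) Q.M Q.mutation (regroup q m) Q.mutation_cocycle"
  unfolding target_cocycle_def
proof
  show "AE y in Q.M. Q.mutation y =
      regroup q m (transf_pow M (odometer q) (Q.mutation_cocycle y) (inv_into X (regroup q m) y))"
  proof (rule AE_I2)
    fix y assume "y \<in> Q.X"
    then show "Q.mutation y =
        regroup q m (transf_pow M (odometer q) (Q.mutation_cocycle y) (inv_into X (regroup q m) y))"
      by (simp add: inv_into_regroup ungroup_in_space transf_pow_odometer regroup_translate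
          regroup_ungroup Q.mutation_def)
  qed
qed measurable

lemma integrably_orbit_equivalent_regroup:
  assumes "\<And>n k. k \<le> 4 * place q (m n) \<Longrightarrow> \<phi> (real k) \<le> b n" "\<And>n. 0 \<le> b n"
    "summable (\<lambda>n. b n / real (place q (m n)))"
  shows "integrably_orbit_equivalent \<phi> M (odometer q) Q.M Q.mutation"
proof -
  have fin: "(\<integral>\<^sup>+ x. ennreal (\<phi> (real_of_int \<bar>Q.odometer_cocycle x\<bar>)) \<partial>Q.M) < \<infinity>"
    "(\<integral>\<^sup>+ x. ennreal (\<phi> (real_of_int \<bar>Q.mutation_cocycle x\<bar>)) \<partial>Q.M) < \<infinity>"
    using Q.nn_integral_cocycles_finite[of \<phi> b] assms by (simp_all add: place_Q)
  have [measurable]: "(\<lambda>y. ennreal (\<phi> (real_of_int \<bar>Q.odometer_cocycle y\<bar>))) \<in> borel_measurable Q.M"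
    by (rule measurable_compose[OF Q.measurable_odometer_cocycle]) simp
  \<comment> \<open>The source cocycle lives on the original space, so its integral is pushed
    forward to the block space.\<close>
  have "(\<integral>\<^sup>+ x. ennreal (\<phi> (real_of_int \<bar>Q.odometer_cocycle (regroup q m x)\<bar>)) \<partial>M) =
      (\<integral>\<^sup>+ y. ennreal (\<phi> (real_of_int \<bar>Q.odometer_cocycle y\<bar>)) \<partial>distr M Q.M (regroup q m))"
    by (subst nn_integral_distr) auto
  then have "(\<integral>\<^sup>+ x. ennreal (\<phi> (real_of_int \<bar>Q.odometer_cocycle (regroup q m x)\<bar>)) \<partial>M) < \<infinity>"
    using fin(1) by (simp only: distr_regroup)
  then show ?thesis
    unfolding integrably_orbit_equivalent_def
    using orbit_equivalence_regroup source_cocycle_regroup target_cocycle_regroup fin(2) by blast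
qed

text \<open>Every factor map of an odometer onto itself is a translation, by ergodicity; here
  \<^term>\<open>s\<close> is 1 or -1, to treat the odometer and its inverse together.\<close>

lemma factor_map_inj:
  assumes g [measurable]: "g \<in> measurable M Q.M" and s: "s = 1 \<or> s = - 1"
    and comm: "AE x in M. g (translate q s x) = translate Q 1 (g x)"
  obtains P where "AE x in M. P x" "\<And>x x'. P x \<Longrightarrow> P x' \<Longrightarrow> g x = g x' \<Longrightarrow> x = x'"
proof -
  \<comment> \<open>The displacement of \<open>g x\<close> from \<open>s\<close> times
    \<open>x\<close> at level \<open>i\<close>. A step raises both terms by 1, because
    \<open>s * s = 1\<close>, so the displacement is invariant.\<close>
  define u where "u i x = (int (trunc Q i (g x)) - s * int (trunc q (m i) x)) mod int (place Q i)"
    for i x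
  have gX: "g x \<in> Q.X" if "x \<in> X" for x using measurable_space[OF g that] .
  have "\<exists>c. AE x in M. u i x = c" for i
  proof -
    have "(\<lambda>x. (\<lambda>v x. (int v - s * int (trunc q (m i) x)) mod int (place Q i)) (trunc Q i (g x)) x)
        \<in> measurable M (count_space UNIV)"
      by (rule measurable_compose_countable[OF measurable_compose[OF measurable_trunc]
            measurable_compose[OF g Q.measurable_trunc]]) simp
    then have [measurable]: "u i \<in> measurable M (count_space UNIV)"
      by (simp add: u_def[abs_def])
    have inv: "AE x in M. u i (translate q s x) = u i x"
      using comm AE_space
    proof eventually_elim
      fix x assume gx: "g (translate q s x) = translate Q 1 (g x)" and x: "x \<in> X"
      have "u i (translate q s x) = ((int (trunc Q i (g x)) + 1) mod int (place Q i)
          - s * ((int (trunc q (m i) x) + s) mod int (place Q i))) mod int (place Q i)"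
        using x by (simp add: u_def gx Q.trunc_translate[OF gX] trunc_translate place_Q)
      also have "\<dots> = ((int (trunc Q i (g x)) + 1) - s * (int (trunc q (m i) x) + s)) mod int (place Q i)"
        by (intro mod_diff_cong) (simp_all add: mod_mult_right_eq)
      also have "(int (trunc Q i (g x)) + 1) - s * (int (trunc q (m i) x) + s) =
          int (trunc Q i (g x)) - s * int (trunc q (m i) x)"
        using s by (auto simp: algebra_simps)
      finally show "u i (translate q s x) = u i x" by (simp add: u_def)
    qed
    \<comment> \<open>For \<open>s = - 1\<close>, invariance is evaluated at the successor of
      \<open>x\<close>, to reach the form that ergodicity expects.\<close>
    have "AE x in M. u i (translate q 1 x) = u i x"
      using s
    proof
      assume s: "s = - 1"
      from AE_translate[OF inv, of 1] AE_space show ?thesis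
        by eventually_elim (use s in simp)
    qed (use inv in simp)
    then show ?thesis using ergodic_translate_constant[of "u i"] by auto
  qed
  then obtain c where "\<And>i. AE x in M. u i x = c i" by metis
  \<comment> \<open>There are countably many levels, so one conull set serves them all; on it
    \<open>g x\<close> determines \<open>x\<close>.\<close>
  then have "AE x in M. \<forall>i. u i x = c i" by (simp add: AE_all_countable)
  then have "AE x in M. x \<in> X \<and> (\<forall>i. u i x = c i)"
    using AE_space by eventually_elim simp
  moreover have "x = y" if x: "x \<in> X" "\<forall>i. u i x = c i" and y: "y \<in> X" "\<forall>i. u i y = c i"
    and xy: "g x = g y" for x y
  proof -
    have "regroup q m x = regroup q m y"
    proof (rule Q.eqI_trunc[where m = 0])
      fix i
      let ?p = "int (place Q i)" and ?x = "int (trunc q (m i) x)" and ?y = "int (trunc q (m i) y)"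
      have "u i x = u i y" using x y by simp
      \<comment> \<open>Equal images and equal displacements leave a congruence of the arguments, in
        which the unit \<open>s\<close> cancels.\<close>
      then have "?p dvd s * ?y - s * ?x"
        by (simp add: u_def xy mod_eq_dvd_iff)
      then have "?p dvd ?x - ?y"
        using s by (auto simp: dvd_diff_commute)
      then have "?x mod ?p = ?y mod ?p" by (simp add: mod_eq_dvd_iff)
      then show "trunc Q i (regroup q m x) = trunc Q i (regroup q m y)"
        using trunc_less[OF x(1), of "m i"] trunc_less[OF y(1), of "m i"] x y
        by (simp add: place_Q trunc_regroup)
    qed (simp_all add: regroup_in_space x y)
    then show "x = y" using x(1) y(1) ungroup_regroup by metis
  qed
  ultimately show thesis by (intro that[of "\<lambda>x. x \<in> X \<and> (\<forall>i. u i x = c i)"]) auto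
qed

text \<open>A conjugacy followed by the twist intertwines \<open>F\<close> with the block odometer,
  hence is injective on a conull set. Carried back through the inverse of the conjugacy, this would
  make the twist injective on a conull set.\<close>

lemma not_conjugate_mutation:
  assumes growth: "\<And>n. 2 ^ (n + 2) \<le> Q n" and s: "s = 1 \<or> s = - 1"
    and F: "\<And>x. x \<in> X \<Longrightarrow> F x = translate q s x"
  shows "\<not> conjugate M F Q.M Q.mutation"
proof
  assume "conjugate M F Q.M Q.mutation"
  then obtain A B f where A: "A \<in> sets M" "AE x in M. x \<in> A" and B: "B \<in> sets Q.M" "AE y in Q.M. y \<in> B"
    and f: "mp_bijection (restrict_space M A) (restrict_space Q.M B) f"
    and comm: "AE x in M. f (F x) = Q.mutation (f x)"
    unfolding conjugate_def by blast
  have AX: "A \<inter> X = A" "B \<inter> Q.X = B"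
    using sets.sets_into_space[OF A(1)] sets.sets_into_space[OF B(1)] by auto
  have spaces: "space (restrict_space M A) = A" "space (restrict_space Q.M B) = B"
    using AX by (simp_all add: space_restrict_space Int_commute)
  \<comment> \<open>The conjugacy is controlled only on \<open>A\<close>; a constant value elsewhere
    gives a measurable map on the whole space.\<close>
  define f' where "f' x = (if x \<in> A then f x else (\<lambda>_. 0))" for x
  have fm: "f \<in> measurable (restrict_space M A) (restrict_space Q.M B)"
    and fbij: "bij_betw f A B"
    and finv: "inv_into A f \<in> measurable (restrict_space Q.M B) (restrict_space M A)"
    and fdistr: "distr (restrict_space M A) (restrict_space Q.M B) f = restrict_space Q.M B"
    and finvdistr: "distr (restrict_space Q.M B) (restrict_space M A) (inv_into A f) = restrict_space M A"
    using f mp_bijection_distr_inv_into[OF f] by (auto simp: mp_bijection_def spaces)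
  have f' [measurable]: "f' \<in> measurable M Q.M"
  proof -
    have "{x \<in> X. x \<in> A} \<in> sets M" using A(1) by simp
    moreover have "f \<in> measurable (restrict_space M A) Q.M"
      using fm by (simp add: measurable_restrict_space2_iff)
    ultimately show ?thesis
      unfolding f'_def using Q.zero_in_space
      by (simp add: measurable_If_restrict_space_iff)
  qed
  have good: "AE x in M. f' x \<in> Q.good"
  proof -
    have "AE y in Q.M. y \<in> B \<longrightarrow> y \<in> Q.good"
      using Q.AE_good by eventually_elim simp
    then have "AE y in restrict_space Q.M B. y \<in> Q.good"
      using B(1) by (simp add: AE_restrict_space_iff AX)
    then have "AE x in restrict_space M A. f x \<in> Q.good"
      by (intro AE_distrD[OF fm]) (simp only: fdistr)
    then have "AE x in M. x \<in> A \<longrightarrow> f x \<in> Q.good"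
      using A(1) by (simp add: AE_restrict_space_iff AX)
    then show ?thesis using A(2) by eventually_elim (simp add: f'_def)
  qed
  define g where "g x = twist Q (f' x)" for x
  have gm: "g \<in> measurable M Q.M" unfolding g_def by measurable
  have gc: "AE x in M. g (translate q s x) = translate Q 1 (g x)"
    using good comm A(2) AE_translate[OF A(2), of s] AE_space
    by eventually_elim (simp add: g_def f'_def F Q.twist_mutation)
  obtain P where P: "AE x in M. P x"
    and inj: "\<And>x x'. P x \<Longrightarrow> P x' \<Longrightarrow> g x = g x' \<Longrightarrow> x = x'"
    by (rule factor_map_inj[OF gm s gc]) (rule that)
  \<comment> \<open>The conull set \<open>P\<close> is carried to the target by the inverse of
    \<open>f\<close>, which preserves the restricted measures.\<close>
  have "AE x in M. x \<in> A \<longrightarrow> P x"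
    using P by eventually_elim simp
  then have "AE x in restrict_space M A. P x"
    using A(1) by (simp add: AE_restrict_space_iff AX)
  then have "AE y in restrict_space Q.M B. P (inv_into A f y)"
    by (intro AE_distrD[OF finv]) (simp only: finvdistr)
  then have "AE y in Q.M. y \<in> B \<longrightarrow> P (inv_into A f y)"
    using B(1) by (simp add: AE_restrict_space_iff AX)
  \<comment> \<open>Membership in \<open>B\<close> is kept in the predicate because the inverse of
    \<open>f\<close> is meaningful there.\<close>
  then have "AE y in Q.M. y \<in> B \<and> P (inv_into A f y)"
    using B(2) by eventually_elim simp
  from Q.twist_not_injective[OF growth this] obtain y z
    where y: "y \<in> B" "P (inv_into A f y)" and z: "z \<in> B" "P (inv_into A f z)"
      and yz: "y \<noteq> z" "twist Q y = twist Q z" by blast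
  have "g (inv_into A f y) = twist Q y" if "y \<in> B" for y
    using bij_betw_inv_into_right[OF fbij that] bij_betwE[OF bij_betw_inv_into[OF fbij]] that
    by (simp add: g_def f'_def)
  then have "inv_into A f y = inv_into A f z"
    using y z yz(2) by (metis inj)
  then show False
    using bij_betw_inv_into_right[OF fbij] y(1) z(1) yz(1) by metis
qed

end

section \<open>Choice of the blocks from the sublinear function, and conclusion\<close>

lemma sublinear_bound:
  fixes \<phi> :: "real \<Rightarrow> real"
  assumes "sublinear \<phi>" "0 < \<epsilon>"
  obtains N where "\<And>p k. N \<le> p \<Longrightarrow> k \<le> 4 * p \<Longrightarrow> \<phi> (real k) \<le> \<epsilon> * real p"
proof -
  \<comment> \<open>The rate \<epsilon> / 4 offsets the factor 4 in the range of
    \<open>k\<close>.\<close>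
  have "eventually (\<lambda>t. \<phi> t / t < \<epsilon> / 4) at_top"
    using assms by (intro order_tendstoD(2)[of _ 0]) (auto simp: sublinear_def)
  then obtain t0 where t0: "\<And>t. t0 \<le> t \<Longrightarrow> \<phi> t / t < \<epsilon> / 4"
    by (auto simp: eventually_at_top_linorder)
  define K where "K = Suc (nat \<lceil>t0\<rceil>)"
  \<comment> \<open>Arguments below \<open>K\<close> escape the growth estimate; their finitely many
    values are bounded by \<open>C\<close>, which \<epsilon> times \<open>p\<close> exceeds or
    equals once \<open>p\<close> is at least \<open>C / \<epsilon>\<close>.\<close>
  define C where "C = Max ((\<lambda>k. \<phi> (real k)) ` {..<K})"
  have C: "\<phi> (real k) \<le> C" if "k < K" for k
    unfolding C_def using that by (intro Max_ge) auto
  show thesis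
  proof (rule that[of "nat \<lceil>C / \<epsilon>\<rceil>"])
    fix p k :: nat assume p: "nat \<lceil>C / \<epsilon>\<rceil> \<le> p" and k: "k \<le> 4 * p"
    show "\<phi> (real k) \<le> \<epsilon> * real p"
    proof (cases "k < K")
      case True
      have "C / \<epsilon> \<le> real p" using p by linarith
      then have "C \<le> \<epsilon> * real p" using assms(2) by (simp add: field_simps)
      then show ?thesis using C[OF True] by simp
    next
      case False
      then have "t0 \<le> real k" "0 < real k" unfolding K_def by linarith+
      then have "\<phi> (real k) \<le> \<epsilon> / 4 * real k" using t0[of "real k"] by (simp add: field_simps)
      also have "\<dots> \<le> \<epsilon> / 4 * (4 * real p)"
        using k assms(2) by (intro mult_left_mono) auto
      finally show ?thesis by simp
    qed
  qed
qed

lemma (in mixed_radix) exists_fast_regrouping: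
  fixes \<phi> :: "real \<Rightarrow> real"
  assumes pos: "\<And>t. 0 \<le> t \<Longrightarrow> 0 \<le> \<phi> t" and sub: "sublinear \<phi>"
  obtains m b where "strict_mono m" "m 0 = 0"
    "\<And>i. 2 ^ (i + 2) * place q (m i) \<le> place q (m (Suc i))"
    "\<And>i k. k \<le> 4 * place q (m i) \<Longrightarrow> \<phi> (real k) \<le> b i" "\<And>i. 0 \<le> b i"
    "summable (\<lambda>i. b i / real (place q (m i)))"
proof -
  \<comment> \<open>The first block must start at 0, so the decay condition is imposed from index 1
    on. \<open>?Q\<close> forces the radix of block \<open>i\<close> to be at least
    \<open>2 ^ (i + 2)\<close>.\<close>
  let ?P = "\<lambda>i n. (i = 0 \<longrightarrow> n = 0) \<and>
    (0 < i \<longrightarrow> (\<forall>k\<le>4 * place q n. \<phi> (real k) \<le> (1/2) ^ i * real (place q n)))"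
  let ?Q = "\<lambda>i n n'. n < n' \<and> 2 ^ (i + 2) * place q n \<le> place q n'"
  have "\<exists>m. \<forall>i. ?P i (m i) \<and> ?Q i (m i) (m (Suc i))"
  proof (rule dependent_nat_choice)
    fix n i
    obtain N where N: "\<And>p k. N \<le> p \<Longrightarrow> k \<le> 4 * p \<Longrightarrow> \<phi> (real k) \<le> (1/2) ^ Suc i * real p"
      using sublinear_bound[OF sub, of "(1/2) ^ Suc i"] by auto
    \<comment> \<open>The \<open>i + 2\<close> extra digits give the required growth, and the
      further \<open>N\<close> bring \<open>place q n'\<close> to the threshold of the sublinear
      bound.\<close>
    define n' where "n' = n + (i + 2) + N"
    have "N \<le> n'" by (simp add: n'_def)
    also have "n' \<le> place q n'"
      using less_le_trans[OF less_exp two_power_le_place] by (rule less_imp_le)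
    finally have "?P (Suc i) n'" using N by auto
    moreover have "?Q i n n'"
    proof
      have "2 ^ (i + 2) * place q n \<le> 2 ^ (i + 2 + N) * place q n"
        by (intro mult_right_mono power_increasing) auto
      also have "\<dots> \<le> place q n'"
        using place_add_ge[of "i + 2 + N" n] by (simp add: n'_def add.assoc)
      finally show "2 ^ (i + 2) * place q n \<le> place q n'" .
    qed (simp add: n'_def)
    ultimately show "\<exists>n'. ?P (Suc i) n' \<and> ?Q i n n'" by blast
  qed simp
  then obtain m where m: "\<And>i. ?P i (m i)" "\<And>i. ?Q i (m i) (m (Suc i))" by blast
  \<comment> \<open>At index 0 the place value is 1, so a plain maximum over arguments up to 4 is
    taken; this single term does not affect summability.\<close>
  define b where "b i = (if i = 0 then Max ((\<lambda>k. \<phi> (real k)) ` {..4}) else (1/2) ^ i * real (place q (m i)))" for i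
  have b0: "\<phi> (real k) \<le> b 0" if "k \<le> 4" for k
    unfolding b_def using that by auto
  have "0 \<le> b i" for i
    using pos[of 0] b0[of 0] by (cases "i = 0") (auto simp: b_def)
  moreover have "\<phi> (real k) \<le> b i" if "k \<le> 4 * place q (m i)" for i k
  proof (cases "i = 0")
    case True
    then show ?thesis using that b0[of k] m(1)[of 0] by simp
  next
    case False
    then show ?thesis using that m(1)[of i] by (simp add: b_def)
  qed
  moreover have "summable (\<lambda>i. b i / real (place q (m i)))"
  proof (rule summable_comparison_test_ev)
    show "eventually (\<lambda>i. norm (b i / real (place q (m i))) \<le> (1/2) ^ i) sequentially"
      using eventually_gt_at_top[of 0] by eventually_elim (simp add: b_def)
  qed (simp add: summable_geometric)
  moreover have "strict_mono m" using m(2) by (simp add: strict_mono_Suc_iff)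
  ultimately show thesis using m(1)[of 0] m(2) by (intro that[of m b]) auto
qed

theorem theorem4:
  fixes \<phi> :: "real \<Rightarrow> real" and q :: "nat \<Rightarrow> nat"
  assumes "\<And>t. 0 \<le> t \<Longrightarrow> 0 \<le> \<phi> t"
    and "sublinear \<phi>"
    and "\<And>n. 2 \<le> q n"
  shows "\<exists>(N :: (nat \<Rightarrow> nat) measure) T.
           pmp_transformation N T \<and>
           integrably_orbit_equivalent \<phi> (odometer_space q) (odometer q) N T \<and>
           \<not> flip_conjugate (odometer_space q) (odometer q) N T"
proof -
  interpret mixed_radix q by standard (rule assms(3))
  obtain m b where m: "strict_mono m" "m 0 = 0"
    and growth: "\<And>i. 2 ^ (i + 2) * place q (m i) \<le> place q (m (Suc i))"
    and b: "\<And>i k. k \<le> 4 * place q (m i) \<Longrightarrow> \<phi> (real k) \<le> b i" "\<And>i. 0 \<le> b i"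
      "summable (\<lambda>i. b i / real (place q (m i)))"
    by (rule exists_fast_regrouping[OF assms(1,2)], assumption) (rule that)
  interpret regrouping q m by standard (rule m)+
  have Q: "2 ^ (n + 2) \<le> Q n" for n
    unfolding regroup_radix_def using growth[of n]
    by (metis div_le_mono nonzero_mult_div_cancel_right not_gr0 place_pos)
  \<comment> \<open>The odometer is translation by 1 and its inverse is translation by -1, the two
    cases of \<open>s\<close>.\<close>
  have "\<not> flip_conjugate M (odometer q) Q.M Q.mutation"
    unfolding flip_conjugate_def
    using not_conjugate_mutation[OF Q, of 1 "odometer q"]
      not_conjugate_mutation[OF Q, of "- 1" "transf_inv M (odometer q)"]
    by (auto simp: odometer_eq_translate transf_inv_odometer)
  then show ?thesis
    using Q.pmp_transformation_mutation integrably_orbit_equivalent_regroup[where \<phi> = \<phi> and b = b, OF b] by blast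
qed

end
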